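(* Let $L$ and $M$ be purely transcendental extensions of a field $K$ of the same finite transcendence degree, and let $G$ be a subgroup of $Aut(M/K)$. Then $G$ is a Noether solution of $M/K$ if and only if there is a nice basis $(\Delta,A)$ of $L/K$ such that (i) $L$ is Galois over $K(\Delta)$, and (ii) $Aut(L/K(\Delta))$ and $G$ are $(L,M)$-spatially isomorphic.
   Context: $Aut(E/F)$ is the group of automorphisms of $E$ fixing $F$; $E^H$ is the fixed field; $E/F$ is Galois if $E^{Aut(E/F)}=F$. A nice basis of $L/K$ is $(\Delta,A)$ with $\Delta$ a transcendence base of $L/K$ and $A$ a basis of $L$ over $K(\Delta)$. A Noether solution of $M/K$ is a subgroup $G\subseteq Aut(M/K)$ with $M$ algebraic over $M^G$ and $M^G$ purely transcendental over $K$. Subgroups $G_1\subseteq Aut(L/K)$ and $G_2\subseteq Aut(M/K)$ are $(L,M)$-spatially isomorphic if there are a group isomorphism $\psi:G_1\to G_2$ and a $K$-isomorphism $\phi:L\to M$ with $g(x)=\phi^{-1}(\psi(g)(\phi(x)))$ for all $g\in G_1$, $x\in L$, and $g(x)=x$ iff $\psi(g)(\phi(x))=\phi(x)$. *)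

theory Defs
  imports Main "HOL-Computational_Algebra.Polynomial" "HOL-Library.Poly_Mapping" "HOL-Algebra.Group"
begin

text \<open>
  Ambient fields are types of class \<open>field\<close>; subfields and intermediate fields are sets of
  elements. An extension \<open>L/K\<close> is an embedding \<open>i\<close> of the field type of \<open>K\<close> into that of \<open>L\<close>,
  and \<open>K\<close> is then identified with the subfield \<open>range i\<close>.
\<close>

definition field_hom :: "('a::field \<Rightarrow> 'b::field) \<Rightarrow> bool" where
  "field_hom f \<longleftrightarrow>
     f 1 = 1 \<and> (\<forall>x y. f (x + y) = f x + f y) \<and> (\<forall>x y. f (x * y) = f x * f y)"

definition is_subfield :: "'a::field set \<Rightarrow> bool" where
  "is_subfield F \<longleftrightarrow> 0 \<in> F \<and> 1 \<in> F \<and>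
     (\<forall>x\<in>F. \<forall>y\<in>F. x + y \<in> F \<and> x * y \<in> F) \<and> (\<forall>x\<in>F. - x \<in> F \<and> inverse x \<in> F)"

definition adjoin :: "'a::field set \<Rightarrow> 'a set \<Rightarrow> 'a set" where
  "adjoin F S = \<Inter>{E. is_subfield E \<and> F \<union> S \<subseteq> E}"

definition algebraic_over :: "'a::field set \<Rightarrow> 'a \<Rightarrow> bool" where
  "algebraic_over F x \<longleftrightarrow>
     (\<exists>p. p \<noteq> 0 \<and> (\<forall>n. Polynomial.coeff p n \<in> F) \<and> poly p x = 0)"

text \<open>
  In a multivariate polynomial of type \<open>('a \<Rightarrow>\<^sub>0 nat) \<Rightarrow>\<^sub>0 'a\<close> the variables are indexed by the
  elements of the field, and \<open>eval_self\<close> substitutes for each variable the element indexing it.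
\<close>

definition eval_self :: "(('a::field \<Rightarrow>\<^sub>0 nat) \<Rightarrow>\<^sub>0 'a) \<Rightarrow> 'a" where
  "eval_self p =
     (\<Sum>m\<in>Poly_Mapping.keys p.
        Poly_Mapping.lookup p m * (\<Prod>x\<in>Poly_Mapping.keys m. x ^ Poly_Mapping.lookup m x))"

definition alg_independent :: "'a::field set \<Rightarrow> 'a set \<Rightarrow> bool" where
  "alg_independent F S \<longleftrightarrow>
     (\<forall>p. (\<forall>m\<in>Poly_Mapping.keys p.
             Poly_Mapping.lookup p m \<in> F \<and> Poly_Mapping.keys m \<subseteq> S) \<longrightarrow>
          eval_self p = 0 \<longrightarrow> p = 0)"

definition transcendence_base :: "'a::field set \<Rightarrow> 'a set \<Rightarrow> 'a set \<Rightarrow> bool" where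
  "transcendence_base F E B \<longleftrightarrow>
     B \<subseteq> E \<and> alg_independent F B \<and> (\<forall>x\<in>E. algebraic_over (adjoin F B) x)"

definition has_finite_trdeg :: "'a::field set \<Rightarrow> 'a set \<Rightarrow> nat \<Rightarrow> bool" where
  "has_finite_trdeg F E n \<longleftrightarrow> (\<exists>B. transcendence_base F E B \<and> finite B \<and> card B = n)"

definition purely_transcendental :: "'a::field set \<Rightarrow> 'a set \<Rightarrow> bool" where
  "purely_transcendental F E \<longleftrightarrow> (\<exists>S. alg_independent F S \<and> E = adjoin F S)"

definition basis_over :: "'a::field set \<Rightarrow> 'a set \<Rightarrow> bool" where
  "basis_over F A \<longleftrightarrow>
     (\<forall>S c. finite S \<and> S \<subseteq> A \<and> c ` S \<subseteq> F \<and> (\<Sum>a\<in>S. c a * a) = 0 \<longrightarrow> (\<forall>a\<in>S. c a = 0)) \<and>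
     (\<forall>x. \<exists>S c. finite S \<and> S \<subseteq> A \<and> c ` S \<subseteq> F \<and> x = (\<Sum>a\<in>S. c a * a))"

definition nice_basis :: "'a::field set \<Rightarrow> 'a set \<Rightarrow> 'a set \<Rightarrow> bool" where
  "nice_basis F \<Delta> A \<longleftrightarrow> transcendence_base F UNIV \<Delta> \<and> basis_over (adjoin F \<Delta>) A"

definition Aut :: "'a::field set \<Rightarrow> ('a \<Rightarrow> 'a) set" where
  "Aut F = {\<sigma>. field_hom \<sigma> \<and> bij \<sigma> \<and> (\<forall>x\<in>F. \<sigma> x = x)}"

definition Aut_group :: "'a::field set \<Rightarrow> ('a \<Rightarrow> 'a) monoid" where
  "Aut_group F = \<lparr>carrier = Aut F, mult = (\<circ>), one = id\<rparr>"

definition fixed_field :: "('a \<Rightarrow> 'a) set \<Rightarrow> 'a::field set" where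
  "fixed_field H = {x. \<forall>\<sigma>\<in>H. \<sigma> x = x}"

definition galois_over :: "'a::field set \<Rightarrow> bool" where
  "galois_over F \<longleftrightarrow> fixed_field (Aut F) = F"

definition noether_solution :: "'a::field set \<Rightarrow> ('a \<Rightarrow> 'a) set \<Rightarrow> bool" where
  "noether_solution F G \<longleftrightarrow>
     subgroup G (Aut_group F) \<and>
     (\<forall>x. algebraic_over (fixed_field G) x) \<and>
     purely_transcendental F (fixed_field G)"

definition spatially_isomorphic ::
  "('k::field \<Rightarrow> 'l::field) \<Rightarrow> ('k \<Rightarrow> 'm::field) \<Rightarrow> ('l \<Rightarrow> 'l) set \<Rightarrow> ('m \<Rightarrow> 'm) set \<Rightarrow> bool" where
  "spatially_isomorphic i j G1 G2 \<longleftrightarrow>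
     subgroup G1 (Aut_group (range i)) \<and> subgroup G2 (Aut_group (range j)) \<and>
     (\<exists>\<psi> \<phi>. \<psi> \<in> iso ((Aut_group (range i))\<lparr>carrier := G1\<rparr>) ((Aut_group (range j))\<lparr>carrier := G2\<rparr>) \<and>
        field_hom \<phi> \<and> bij \<phi> \<and> (\<forall>k. \<phi> (i k) = j k) \<and>
        (\<forall>g\<in>G1. \<forall>x. g x = the_inv \<phi> (\<psi> g (\<phi> x)) \<and> (g x = x \<longleftrightarrow> \<psi> g (\<phi> x) = \<phi> x)))"

lemma field_hom_comp: "field_hom f \<Longrightarrow> field_hom g \<Longrightarrow> field_hom (f \<circ> g)"
  by (simp add: field_hom_def)

lemma Aut_inv: "\<sigma> \<in> Aut F \<Longrightarrow> inv_into UNIV \<sigma> \<in> Aut F"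
proof -
  assume "\<sigma> \<in> Aut F"
  then have h: "field_hom \<sigma>" "bij \<sigma>" "\<forall>x\<in>F. \<sigma> x = x" by (auto simp: Aut_def)
  let ?t = "inv_into UNIV \<sigma>"
  have s: "\<sigma> (?t x) = x" and t: "?t (\<sigma> x) = x" for x
    using h(2) by (simp_all add: bij_is_surj surj_f_inv_f bij_is_inj)
  have "?t 1 = 1" "?t (x + y) = ?t x + ?t y" "?t (x * y) = ?t x * ?t y" for x y
    using h(1) s t unfolding field_hom_def by metis+
  moreover have "\<forall>x\<in>F. ?t x = x" using h(3) t by metis
  ultimately show ?thesis using h(2) by (simp add: Aut_def field_hom_def bij_imp_bij_inv)
qed

lemma group_Aut_group: "group (Aut_group F)"
proof (rule groupI)
  fix \<sigma> assume "\<sigma> \<in> carrier (Aut_group F)"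
  then have s: "\<sigma> \<in> Aut F" by (simp add: Aut_group_def)
  then have "inv_into UNIV \<sigma> \<circ> \<sigma> = id" by (auto simp: Aut_def bij_is_inj)
  then show "\<exists>\<tau>\<in>carrier (Aut_group F). \<tau> \<otimes>\<^bsub>Aut_group F\<^esub> \<sigma> = \<one>\<^bsub>Aut_group F\<^esub>"
    using Aut_inv[OF s] by (auto simp: Aut_group_def)
qed (auto simp: Aut_group_def Aut_def field_hom_comp bij_comp field_hom_def o_assoc)

lemma is_subfield_adjoin: "is_subfield (adjoin F S)"
  unfolding adjoin_def is_subfield_def by blast

end

theory Submission imports Defs "HOL-Algebra.Algebraic_Closure_Type" begin

text \<open>
  By the exchange property for algebraic dependence, \<open>L\<close> and \<open>M\<close> are generated over \<open>K\<close> by algebraically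
  independent sets of the same finite size, so there is a \<open>K\<close>-isomorphism \<open>\<phi> : L \<rightarrow> M\<close>. A spatial
  isomorphism is nothing but conjugation by such a \<open>\<phi>\<close>, which carries fixed fields to fixed fields and
  transcendence bases to transcendence bases. If \<open>G\<close> is a Noether solution, then \<open>M\<close> is finitely generated
  and algebraic over \<open>M\<^sup>G\<close>, so \<open>G\<close> is finite and \<open>G = Aut(M/M\<^sup>G)\<close> by Artin's theorem; hence \<open>G\<close> is conjugate
  to \<open>Aut(L/K(\<Delta>))\<close> for the preimage \<open>\<Delta>\<close> of a transcendence base generating \<open>M\<^sup>G\<close>. Conversely, conjugation
  carries the fixed field \<open>K(\<Delta>)\<close> to \<open>M\<^sup>G\<close>.
\<close>

section \<open>Homomorphisms\<close>

definition unital_hom :: "('a::comm_ring_1 \<Rightarrow> 'b::comm_ring_1) \<Rightarrow> bool" where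
  "unital_hom f \<longleftrightarrow> f 0 = 0 \<and> f 1 = 1 \<and>
     (\<forall>x y. f (x + y) = f x + f y) \<and> (\<forall>x y. f (x * y) = f x * f y)"

lemma unital_homD:
  assumes "unital_hom f"
  shows "f 0 = 0" "f 1 = 1" "f (x + y) = f x + f y" "f (x * y) = f x * f y"
  using assms by (auto simp: unital_hom_def)

lemma unital_hom_uminus: "unital_hom f \<Longrightarrow> f (- x) = - f x"
  by (metis add.right_inverse minus_unique unital_homD(1,3))

lemma unital_hom_diff: "unital_hom f \<Longrightarrow> f (x - y) = f x - f y"
  by (simp only: diff_conv_add_uminus unital_homD(3) unital_hom_uminus)

lemma unital_hom_sum: "unital_hom f \<Longrightarrow> f (sum g A) = (\<Sum>x\<in>A. f (g x))"
  by (induction A rule: infinite_finite_induct) (auto simp: unital_homD)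

lemma unital_hom_prod: "unital_hom f \<Longrightarrow> f (prod g A) = (\<Prod>x\<in>A. f (g x))"
  by (induction A rule: infinite_finite_induct) (auto simp: unital_homD)

lemma unital_hom_power: "unital_hom f \<Longrightarrow> f (x ^ n) = f x ^ n"
  by (induction n) (auto simp: unital_homD)

lemma unital_hom_ident: "unital_hom (\<lambda>x. x)"
  by (simp add: unital_hom_def)

lemma unital_hom_const_poly: "unital_hom (\<lambda>a. [:a:])"
  by (auto simp: unital_hom_def one_pCons)

lemma unital_hom_poly: "unital_hom (\<lambda>p. poly p x)"
  by (simp add: unital_hom_def)

lemma coeff_map_poly_hom:
  "unital_hom f \<Longrightarrow> Polynomial.coeff (map_poly f p) n = f (Polynomial.coeff p n)"
  by (simp add: coeff_map_poly unital_homD)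

lemma unital_hom_map_poly:
  assumes "unital_hom f"
  shows "unital_hom (map_poly f)"
  unfolding unital_hom_def
  using assms
  by (simp add: poly_eq_iff coeff_map_poly_hom coeff_mult unital_homD unital_hom_sum)

lemma poly_map_poly_hom:
  assumes "unital_hom f"
  shows "poly (map_poly f p) (f x) = f (poly p x)"
  using assms by (induction p) (simp_all add: map_poly_pCons unital_homD)

lemma field_hom_unital_hom:
  assumes "field_hom f"
  shows "unital_hom f"
proof -
  have "f 0 + f 0 = f 0" using assms by (metis add_0 field_hom_def)
  then have "f 0 = 0" by (simp only: add_cancel_left_left)
  then show ?thesis using assms by (simp add: field_hom_def unital_hom_def)
qed

lemma field_hom_eq_0_iff:
  assumes "field_hom f"
  shows "f x = 0 \<longleftrightarrow> x = 0"
proof (cases "x = 0")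
  case True
  then show ?thesis using assms by (simp add: field_hom_unital_hom unital_homD)
next
  case False
  then have "f x * f (inverse x) = 1"
    using assms by (metis field_hom_def right_inverse)
  then show ?thesis using False by auto
qed

lemma field_hom_inverse:
  assumes "field_hom f"
  shows "f (inverse x) = inverse (f x)"
proof (cases "x = 0")
  case True
  then show ?thesis using assms by (simp add: field_hom_unital_hom unital_homD)
next
  case False
  then have "f x * f (inverse x) = 1"
    using assms by (metis field_hom_def right_inverse)
  then show ?thesis by (metis inverse_unique)
qed

lemmas field_hom_simps =
  unital_homD[OF field_hom_unital_hom] unital_hom_uminus[OF field_hom_unital_hom] field_hom_inverse

lemma field_hom_inj: "field_hom f \<Longrightarrow> inj f"
  using unital_hom_diff[OF field_hom_unital_hom, of f] field_hom_eq_0_iff[of f]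
  by (metis injI right_minus_eq)

lemma field_hom_the_inv:
  assumes "field_hom f" "bij f"
  shows "field_hom (the_inv f)"
proof -
  have "the_inv f (f x) = x" "f (the_inv f y) = y" for x y
    using assms(2) by (simp_all add: bij_is_inj the_inv_f_f f_the_inv_into_f_bij_betw)
  then show ?thesis
    using assms(1) unfolding field_hom_def by metis
qed

section \<open>Subrings, fractions and adjunction\<close>

definition subring_set :: "'a::comm_ring_1 set \<Rightarrow> bool" where
  "subring_set D \<longleftrightarrow> 1 \<in> D \<and> (\<forall>x\<in>D. \<forall>y\<in>D. x + y \<in> D \<and> x * y \<in> D) \<and> (\<forall>x\<in>D. - x \<in> D)"

lemma subring_setD:
  assumes "subring_set D"
  shows "0 \<in> D" "1 \<in> D" "x \<in> D \<Longrightarrow> y \<in> D \<Longrightarrow> x + y \<in> D" "x \<in> D \<Longrightarrow> y \<in> D \<Longrightarrow> x * y \<in> D"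
    "x \<in> D \<Longrightarrow> - x \<in> D" "x \<in> D \<Longrightarrow> y \<in> D \<Longrightarrow> x - y \<in> D"
proof -
  show "0 \<in> D" using assms unfolding subring_set_def by (metis add.right_inverse)
  show "x - y \<in> D" if "x \<in> D" "y \<in> D"
    using assms that unfolding subring_set_def by (metis diff_conv_add_uminus)
qed (use assms in \<open>auto simp: subring_set_def\<close>)

lemma subring_set_sum: "subring_set D \<Longrightarrow> (\<And>x. x \<in> A \<Longrightarrow> g x \<in> D) \<Longrightarrow> sum g A \<in> D"
  by (induction A rule: infinite_finite_induct) (auto simp: subring_setD)

lemma subring_set_prod: "subring_set D \<Longrightarrow> (\<And>x. x \<in> A \<Longrightarrow> g x \<in> D) \<Longrightarrow> prod g A \<in> D"
  by (induction A rule: infinite_finite_induct) (auto simp: subring_setD)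

lemma subring_set_power: "subring_set D \<Longrightarrow> x \<in> D \<Longrightarrow> x ^ n \<in> D"
  by (induction n) (auto simp: subring_setD)

lemma subring_set_UNIV: "subring_set UNIV"
  by (simp add: subring_set_def)

lemma subring_set_image:
  assumes f: "unital_hom f" and D: "subring_set D"
  shows "subring_set (f ` D)"
  unfolding subring_set_def
proof (intro conjI ballI)
  show "1 \<in> f ` D" using imageI[OF subring_setD(2)[OF D], of f] by (simp add: unital_homD[OF f])
qed (auto simp: subring_setD[OF D] simp flip: unital_homD(3,4)[OF f] unital_hom_uminus[OF f])

lemma is_subfield_iff_subring_set:
  "is_subfield F \<longleftrightarrow> subring_set F \<and> (\<forall>x\<in>F. inverse x \<in> F)"
  using subring_setD(1)[of F] by (auto simp: is_subfield_def subring_set_def)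

lemma is_subfield_imp_subring_set: "is_subfield F \<Longrightarrow> subring_set F"
  by (simp add: is_subfield_iff_subring_set)

lemma is_subfield_UNIV: "is_subfield UNIV"
  by (simp add: is_subfield_def)

lemma is_subfield_image:
  assumes f: "field_hom f" and F: "is_subfield F"
  shows "is_subfield (f ` F)"
  using F unfolding is_subfield_iff_subring_set
  by (auto simp: subring_set_image field_hom_unital_hom[OF f] simp flip: field_hom_inverse[OF f])

lemma is_subfield_range: "field_hom f \<Longrightarrow> is_subfield (range f)"
  by (simp add: is_subfield_image is_subfield_UNIV)

lemma is_subfield_vimage: "field_hom f \<Longrightarrow> is_subfield F \<Longrightarrow> is_subfield (f -` F)"
  unfolding is_subfield_def by (auto simp: field_hom_simps)

lemma is_subfield_equalizer: "field_hom f \<Longrightarrow> field_hom g \<Longrightarrow> is_subfield {x. f x = g x}"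
  unfolding is_subfield_def by (auto simp: field_hom_simps)

lemma adjoin_upper: "F \<subseteq> adjoin F S" "S \<subseteq> adjoin F S"
  by (auto simp: adjoin_def)

lemma adjoin_least: "is_subfield E \<Longrightarrow> F \<subseteq> E \<Longrightarrow> S \<subseteq> E \<Longrightarrow> adjoin F S \<subseteq> E"
  by (auto simp: adjoin_def)

lemma adjoin_mono: "F \<subseteq> E \<Longrightarrow> S \<subseteq> T \<Longrightarrow> adjoin F S \<subseteq> adjoin E T"
  by (meson adjoin_least adjoin_upper is_subfield_adjoin subset_trans)

lemma adjoin_adjoin: "adjoin (adjoin F S) T = adjoin F (S \<union> T)"
proof
  show "adjoin (adjoin F S) T \<subseteq> adjoin F (S \<union> T)"
    using adjoin_upper(2)[of "S \<union> T" F] by (intro adjoin_least is_subfield_adjoin adjoin_mono) auto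
  show "adjoin F (S \<union> T) \<subseteq> adjoin (adjoin F S) T"
    using adjoin_upper(1)[of F S] adjoin_upper(2)[of S F] adjoin_upper[where F="adjoin F S" and S=T]
    by (intro adjoin_least is_subfield_adjoin) auto
qed

lemma image_adjoin:
  assumes f: "field_hom f"
  shows "f ` adjoin F S = adjoin (f ` F) (f ` S)"
proof
  have "adjoin F S \<subseteq> f -` adjoin (f ` F) (f ` S)"
    using adjoin_upper[of "f ` F" "f ` S"] adjoin_upper[of "f ` S" "f ` F"]
    by (intro adjoin_least is_subfield_vimage is_subfield_adjoin f) auto
  then show "f ` adjoin F S \<subseteq> adjoin (f ` F) (f ` S)" by auto
  show "adjoin (f ` F) (f ` S) \<subseteq> f ` adjoin F S"
    by (intro adjoin_least is_subfield_image is_subfield_adjoin f image_mono adjoin_upper)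
qed

definition fractions :: "'a::field set \<Rightarrow> 'a set" where
  "fractions D = {a / b |a b. a \<in> D \<and> b \<in> D \<and> b \<noteq> 0}"

lemma fractionsI: "a \<in> D \<Longrightarrow> b \<in> D \<Longrightarrow> b \<noteq> 0 \<Longrightarrow> a / b \<in> fractions D"
  by (auto simp: fractions_def)

lemma fractionsE:
  assumes "x \<in> fractions D"
  obtains a b where "a \<in> D" "b \<in> D" "b \<noteq> 0" "x = a / b"
  using assms by (auto simp: fractions_def)

lemma subset_fractions: "subring_set D \<Longrightarrow> D \<subseteq> fractions D"
  using fractionsI[where D=D and b=1] by (auto simp: subring_setD)

lemma is_subfield_fractions:
  assumes D: "subring_set D"
  shows "is_subfield (fractions D)"
proof -
  have "x + y \<in> fractions D \<and> x * y \<in> fractions D"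
    if in_fractions: "x \<in> fractions D" "y \<in> fractions D" for x y
  proof -
    obtain a b c d where quotients: "a \<in> D" "b \<in> D" "b \<noteq> 0" "x = a / b"
      "c \<in> D" "d \<in> D" "d \<noteq> 0" "y = c / d"
      using in_fractions by (metis fractionsE)
    then have "x + y = (a * d + c * b) / (b * d)" "x * y = (a * c) / (b * d)"
      by (simp_all add: field_simps)
    then show ?thesis
      using quotients by (auto intro!: fractionsI subring_setD[OF D])
  qed
  moreover have "- x \<in> fractions D \<and> inverse x \<in> fractions D" if x: "x \<in> fractions D" for x
  proof -
    obtain a b where quotient: "a \<in> D" "b \<in> D" "b \<noteq> 0" "x = a / b"
      using x by (rule fractionsE)
    then have "- x \<in> fractions D"
      using fractionsI[of "- a" D b] by (simp add: subring_setD[OF D])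
    moreover have "inverse x \<in> fractions D"
      using quotient x fractionsI[of b D a] by (cases "a = 0") simp_all
    ultimately show ?thesis ..
  qed
  ultimately show ?thesis
    using subset_fractions[OF D] subring_setD(1,2)[OF D] unfolding is_subfield_def by blast
qed

lemma adjoin_subset_fractions:
  assumes "subring_set D" "F \<subseteq> D" "S \<subseteq> D"
  shows "adjoin F S \<subseteq> fractions D"
  using assms subset_fractions[of D] by (intro adjoin_least is_subfield_fractions) auto

lemma common_denominator:
  assumes D: "subring_set D" and A: "finite A" "A \<subseteq> fractions D"
  obtains b where "b \<in> D" "b \<noteq> 0" "\<And>a. a \<in> A \<Longrightarrow> a * b \<in> D"
  using A
proof (induction A arbitrary: thesis)
  case empty
  then show ?case using subring_setD(2)[OF D] by (metis empty_iff zero_neq_one)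
next
  case (insert x A)
  from insert.prems insert.IH obtain b where b: "b \<in> D" "b \<noteq> 0" "\<And>a. a \<in> A \<Longrightarrow> a * b \<in> D"
    by blast
  from insert.prems obtain c d where quotient: "c \<in> D" "d \<in> D" "d \<noteq> 0" "x = c / d"
    by (meson fractionsE insert_subset)
  have "a * (b * d) \<in> D" if "a \<in> insert x A" for a
  proof (cases "a = x")
    case True
    then have "a * (b * d) = b * c" using quotient by simp
    then show ?thesis by (metis subring_setD(4)[OF D b(1) quotient(1)])
  next
    case False
    then show ?thesis
      using that b(3) quotient(2) by (simp add: subring_setD[OF D] flip: mult.assoc)
  qed
  then show ?case
    using insert.prems(1)[of "b * d"] b(1,2) quotient(2,3) by (simp add: subring_setD[OF D])
qed

lemma hom_quotient_eq:
  fixes e :: "'r::comm_ring_1 \<Rightarrow> 'l::field" and f :: "'r \<Rightarrow> 'm::field"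
  assumes e: "unital_hom e" and f: "unital_hom f" and D: "subring_set D"
    and ker: "\<And>p. p \<in> D \<Longrightarrow> e p = 0 \<longleftrightarrow> f p = 0"
    and in_D: "p \<in> D" "q \<in> D" "p' \<in> D" "q' \<in> D"
    and nonzero: "e q \<noteq> 0" "e q' \<noteq> 0" and eq: "e p / e q = e p' / e q'"
  shows "f p / f q = f p' / f q'"
proof -
  have "e (p * q' - p' * q) = 0"
    using eq nonzero by (simp add: unital_hom_diff[OF e] unital_homD(4)[OF e] frac_eq_eq)
  then have "f (p * q' - p' * q) = 0"
    using ker in_D by (simp add: subring_setD[OF D])
  then have "f p * f q' = f p' * f q"
    by (simp add: unital_hom_diff[OF f] unital_homD(4)[OF f])
  moreover have "f q \<noteq> 0" "f q' \<noteq> 0" using ker in_D nonzero by auto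
  ultimately show ?thesis by (simp add: frac_eq_eq)
qed

lemma fraction_hom_extension:
  fixes e :: "'r::comm_ring_1 \<Rightarrow> 'l::field" and f :: "'r \<Rightarrow> 'm::field"
  assumes e: "unital_hom e" and f: "unital_hom f" and D: "subring_set D"
    and ker: "\<And>p. p \<in> D \<Longrightarrow> e p = 0 \<longleftrightarrow> f p = 0"
    and surj: "fractions (e ` D) = UNIV"
  obtains \<phi> where "field_hom \<phi>" "\<And>p. p \<in> D \<Longrightarrow> \<phi> (e p) = f p"
proof -
  have "\<exists>p q. p \<in> D \<and> q \<in> D \<and> e q \<noteq> 0 \<and> x = e p / e q" for x
    by (rule fractionsE[of x "e ` D"]) (auto simp: surj)
  then obtain num den where num_den: "\<And>x. num x \<in> D" "\<And>x. den x \<in> D" "\<And>x. e (den x) \<noteq> 0"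
    and eq_num_den: "\<And>x. x = e (num x) / e (den x)"
    by metis
  define \<phi> where "\<phi> x = f (num x) / f (den x)" for x
  have f_den: "f (den x) \<noteq> 0" for x using ker num_den by blast
  have \<phi>_fraction: "\<phi> x = f p / f q" if "p \<in> D" "q \<in> D" "e q \<noteq> 0" "x = e p / e q" for x p q
    unfolding \<phi>_def using that num_den eq_num_den[of x]
    by (intro hom_quotient_eq[OF e f D ker]) auto
  have \<phi>_e: "\<phi> (e p) = f p" if "p \<in> D" for p
    using \<phi>_fraction[of p 1 "e p"] that
    by (simp add: unital_homD[OF e] unital_homD[OF f] subring_setD[OF D])
  have "\<phi> (x + y) = \<phi> x + \<phi> y" for x y
  proof -
    have "x + y = e (num x) / e (den x) + e (num y) / e (den y)"
      by (simp only: eq_num_den[symmetric])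
    also have "\<dots> = e (num x * den y + num y * den x) / e (den x * den y)"
      by (simp add: unital_homD[OF e] add_frac_eq num_den)
    finally have "\<phi> (x + y) = f (num x * den y + num y * den x) / f (den x * den y)"
      by (intro \<phi>_fraction) (simp_all add: unital_homD[OF e] num_den subring_setD[OF D])
    then show ?thesis by (simp add: unital_homD[OF f] \<phi>_def add_frac_eq f_den)
  qed
  moreover have "\<phi> (x * y) = \<phi> x * \<phi> y" for x y
  proof -
    have "x * y = e (num x * num y) / e (den x * den y)"
      using eq_num_den[of x] eq_num_den[of y] by (metis times_divide_times_eq unital_homD(4)[OF e])
    then have "\<phi> (x * y) = f (num x * num y) / f (den x * den y)"
      by (intro \<phi>_fraction) (simp_all add: unital_homD[OF e] num_den subring_setD[OF D])
    then show ?thesis by (simp add: unital_homD[OF f] \<phi>_def)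
  qed
  moreover have "\<phi> 1 = 1"
    using \<phi>_e[OF subring_setD(2)[OF D]] by (simp add: unital_homD[OF e] unital_homD[OF f])
  ultimately have "field_hom \<phi>" by (simp add: field_hom_def)
  then show ?thesis using \<phi>_e that by blast
qed

section \<open>Algebraic elements\<close>

definition polys_over :: "'a::zero set \<Rightarrow> 'a poly set" where
  "polys_over F = {p. \<forall>n. Polynomial.coeff p n \<in> F}"

lemma polys_overD: "p \<in> polys_over F \<Longrightarrow> Polynomial.coeff p n \<in> F"
  by (simp add: polys_over_def)

lemma set_coeffs_polys_over: "p \<in> polys_over F \<Longrightarrow> set (coeffs p) \<subseteq> F"
  by (auto simp: coeffs_def polys_over_def)

lemma polys_over_mono: "F \<subseteq> E \<Longrightarrow> polys_over F \<subseteq> polys_over E"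
  by (auto simp: polys_over_def)

lemma map_poly_polys_over: "unital_hom f \<Longrightarrow> p \<in> polys_over F \<Longrightarrow> map_poly f p \<in> polys_over (f ` F)"
  by (simp add: polys_over_def coeff_map_poly_hom)

lemma map_poly_eq_self_iff:
  "unital_hom f \<Longrightarrow> map_poly f p = p \<longleftrightarrow> p \<in> polys_over {a. f a = a}"
  by (simp add: polys_over_def poly_eq_iff coeff_map_poly_hom)

lemma subring_set_polys_over:
  assumes F: "subring_set F"
  shows "subring_set (polys_over F)"
  unfolding subring_set_def[of "polys_over F"]
  by (auto simp: polys_over_def subring_setD[OF F] coeff_mult intro!: subring_set_sum[OF F])

lemma pCons_polys_over: "a \<in> F \<Longrightarrow> p \<in> polys_over F \<Longrightarrow> pCons a p \<in> polys_over F"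
  by (simp add: polys_over_def Polynomial.coeff_pCons split: nat.splits)

lemma smult_polys_over:
  "subring_set F \<Longrightarrow> a \<in> F \<Longrightarrow> p \<in> polys_over F \<Longrightarrow> Polynomial.smult a p \<in> polys_over F"
  by (simp add: polys_over_def subring_setD)

lemma algebraic_over_iff:
  "algebraic_over F x \<longleftrightarrow> (\<exists>p\<in>polys_over F. p \<noteq> 0 \<and> poly p x = 0)"
  by (auto simp: algebraic_over_def polys_over_def)

lemma algebraic_overE:
  assumes "algebraic_over F x"
  obtains p where "p \<in> polys_over F" "p \<noteq> 0" "poly p x = 0"
  using assms by (auto simp: algebraic_over_iff)

lemma algebraic_over_mono: "F \<subseteq> E \<Longrightarrow> algebraic_over F x \<Longrightarrow> algebraic_over E x"
  unfolding algebraic_over_iff using polys_over_mono by blast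

lemma algebraic_over_self:
  assumes F: "subring_set F" and x: "x \<in> F"
  shows "algebraic_over F x"
proof -
  have "[:- x, 1:] \<in> polys_over F"
    by (intro pCons_polys_over subring_setD F x subring_set_polys_over)
  then show ?thesis
    unfolding algebraic_over_iff by (intro bexI[of _ "[:- x, 1:]"]) auto
qed

lemma algebraic_over_image:
  assumes f: "field_hom f" and x: "algebraic_over F x"
  shows "algebraic_over (f ` F) (f x)"
proof -
  obtain p where p: "p \<in> polys_over F" "p \<noteq> 0" "poly p x = 0"
    using x by (rule algebraic_overE)
  note hom_f = field_hom_unital_hom[OF f]
  have "map_poly f p \<noteq> 0"
    using p(2) by (simp add: poly_eq_iff coeff_map_poly_hom[OF hom_f] field_hom_eq_0_iff[OF f])
  moreover have "poly (map_poly f p) (f x) = 0"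
    by (simp add: poly_map_poly_hom[OF hom_f] p(3) unital_homD[OF hom_f])
  ultimately show ?thesis
    using map_poly_polys_over[OF hom_f p(1)] by (auto simp: algebraic_over_iff)
qed

lemma algebraic_over_fractions:
  assumes D: "subring_set D" and x: "algebraic_over (fractions D) x"
  shows "algebraic_over D x"
proof -
  obtain p where p: "p \<in> polys_over (fractions D)" "p \<noteq> 0" "poly p x = 0"
    using x by (rule algebraic_overE)
  obtain b where b: "b \<in> D" "b \<noteq> 0" "\<And>a. a \<in> set (coeffs p) \<Longrightarrow> a * b \<in> D"
    using common_denominator[OF D _ set_coeffs_polys_over[OF p(1)]] by auto
  have "b * Polynomial.coeff p n \<in> D" for n
    using b(3)[of "Polynomial.coeff p n"] coeff_in_coeffs[OF p(2), of n] coeff_eq_0[of p n]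
      subring_setD(1)[OF D]
    by (cases "n \<le> Polynomial.degree p") (auto simp: mult.commute)
  then have "Polynomial.smult b p \<in> polys_over D"
    by (simp add: polys_over_def)
  then show ?thesis
    unfolding algebraic_over_iff using b(2) p by (intro bexI[of _ "Polynomial.smult b p"]) auto
qed

lemma adjoin_singleton_subset_fractions:
  assumes F: "subring_set F"
  shows "adjoin F {b} \<subseteq> fractions ((\<lambda>p. poly p b) ` polys_over F)"
proof (rule adjoin_subset_fractions)
  show "subring_set ((\<lambda>p. poly p b) ` polys_over F)"
    by (rule subring_set_image[OF unital_hom_poly subring_set_polys_over[OF F]])
  note polys_over_simps =
    pCons_polys_over subring_setD[OF F] subring_setD(1)[OF subring_set_polys_over[OF F]]
  show "F \<subseteq> (\<lambda>p. poly p b) ` polys_over F"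
  proof
    fix a assume "a \<in> F"
    then have "[:a:] \<in> polys_over F" by (simp add: polys_over_simps)
    from imageI[OF this, of "\<lambda>p. poly p b"] show "a \<in> (\<lambda>p. poly p b) ` polys_over F" by simp
  qed
  have "[:0, 1:] \<in> polys_over F" by (simp add: polys_over_simps)
  from imageI[OF this, of "\<lambda>p. poly p b"] show "{b} \<subseteq> (\<lambda>p. poly p b) ` polys_over F" by simp
qed

section \<open>Polynomials in several variables\<close>

type_synonym ('x, 'a) mpoly = "('x \<Rightarrow>\<^sub>0 nat) \<Rightarrow>\<^sub>0 'a"

definition const_mpoly :: "'a \<Rightarrow> ('x, 'a::zero) mpoly" where
  "const_mpoly a = Poly_Mapping.single 0 a"

definition var_mpoly :: "'x \<Rightarrow> ('x, 'a::zero_neq_one) mpoly" where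
  "var_mpoly x = Poly_Mapping.single (Poly_Mapping.single x 1) 1"

definition monom_eval :: "('x \<Rightarrow> 'b::comm_monoid_mult) \<Rightarrow> ('x \<Rightarrow>\<^sub>0 nat) \<Rightarrow> 'b" where
  "monom_eval v m = (\<Prod>x\<in>Poly_Mapping.keys m. v x ^ Poly_Mapping.lookup m x)"

definition mpoly_eval ::
  "('a::zero \<Rightarrow> 'b::comm_semiring_1) \<Rightarrow> ('x \<Rightarrow> 'b) \<Rightarrow> ('x, 'a) mpoly \<Rightarrow> 'b" where
  "mpoly_eval c v p = (\<Sum>m\<in>Poly_Mapping.keys p. c (Poly_Mapping.lookup p m) * monom_eval v m)"

lemma eval_self_eq_mpoly_eval: "eval_self = mpoly_eval (\<lambda>a. a) (\<lambda>x. x)"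
  by (simp add: fun_eq_iff eval_self_def mpoly_eval_def monom_eval_def)

lemma unital_hom_const_mpoly: "unital_hom const_mpoly"
  by (simp add: unital_hom_def const_mpoly_def single_add mult_single)

lemma poly_mapping_eq_sum_single:
  "p = (\<Sum>m\<in>Poly_Mapping.keys p. Poly_Mapping.single m (Poly_Mapping.lookup p m))"
  by (rule poly_mapping_eqI) (simp add: lookup_sum lookup_single when_def in_keys_iff)

lemma poly_mapping_mult_eq_sum_single:
  "p * q = (\<Sum>m\<in>Poly_Mapping.keys p. \<Sum>n\<in>Poly_Mapping.keys q.
     Poly_Mapping.single (m + n) (Poly_Mapping.lookup p m * Poly_Mapping.lookup q n))"
proof -
  have "p * q = (\<Sum>m\<in>Poly_Mapping.keys p. Poly_Mapping.single m (Poly_Mapping.lookup p m)) *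
      (\<Sum>n\<in>Poly_Mapping.keys q. Poly_Mapping.single n (Poly_Mapping.lookup q n))"
    by (simp only: poly_mapping_eq_sum_single[symmetric])
  then show ?thesis by (simp only: sum_product mult_single)
qed

lemma monom_eval_superset:
  assumes "finite A" "Poly_Mapping.keys m \<subseteq> A"
  shows "monom_eval v m = (\<Prod>x\<in>A. v x ^ Poly_Mapping.lookup m x)"
  unfolding monom_eval_def
  by (rule prod.mono_neutral_left) (use assms in \<open>auto simp: in_keys_iff\<close>)

lemma monom_eval_0 [simp]: "monom_eval v 0 = 1"
  by (simp add: monom_eval_def)

lemma monom_eval_add: "monom_eval v (m + m') = monom_eval v m * monom_eval v m'"
proof -
  let ?A = "Poly_Mapping.keys m \<union> Poly_Mapping.keys m'"
  have "monom_eval v (m + m') = (\<Prod>x\<in>?A. v x ^ Poly_Mapping.lookup (m + m') x)"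
    by (rule monom_eval_superset) (simp_all add: keys_add)
  also have "\<dots> = (\<Prod>x\<in>?A. v x ^ Poly_Mapping.lookup m x) * (\<Prod>x\<in>?A. v x ^ Poly_Mapping.lookup m' x)"
    by (simp add: lookup_add power_add prod.distrib)
  also have "\<dots> = monom_eval v m * monom_eval v m'"
    by (simp add: monom_eval_superset[of ?A])
  finally show ?thesis .
qed

lemma mpoly_eval_superset:
  assumes "c 0 = 0" "finite A" "Poly_Mapping.keys p \<subseteq> A"
  shows "mpoly_eval c v p = (\<Sum>m\<in>A. c (Poly_Mapping.lookup p m) * monom_eval v m)"
  unfolding mpoly_eval_def
  by (rule sum.mono_neutral_left) (use assms in \<open>auto simp: in_keys_iff\<close>)

lemma mpoly_eval_0 [simp]: "mpoly_eval c v 0 = 0"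
  by (simp add: mpoly_eval_def)

lemma mpoly_eval_single: "c 0 = 0 \<Longrightarrow> mpoly_eval c v (Poly_Mapping.single m a) = c a * monom_eval v m"
  by (simp add: mpoly_eval_def)

lemma mpoly_eval_const: "c 0 = 0 \<Longrightarrow> mpoly_eval c v (const_mpoly a) = c a"
  by (simp add: const_mpoly_def mpoly_eval_single)

lemma mpoly_eval_var: "unital_hom c \<Longrightarrow> mpoly_eval c v (var_mpoly x) = v x"
  by (simp add: var_mpoly_def mpoly_eval_single unital_homD monom_eval_def)

lemma unital_hom_mpoly_eval:
  fixes c :: "'a::comm_ring_1 \<Rightarrow> 'b::comm_ring_1" and v :: "'x \<Rightarrow> 'b"
  assumes c: "unital_hom c"
  shows "unital_hom (mpoly_eval c v)"
proof -
  have c_zero: "c 0 = 0" by (rule unital_homD(1)[OF c])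
  have add: "mpoly_eval c v (p + q) = mpoly_eval c v p + mpoly_eval c v q" for p q
    unfolding mpoly_eval_def
    by (rule setsum_keys_plus_distrib) (simp_all add: unital_homD[OF c] distrib_right)
  have sum: "mpoly_eval c v (sum f A) = (\<Sum>x\<in>A. mpoly_eval c v (f x))"
    for f :: "('x \<Rightarrow>\<^sub>0 nat) \<Rightarrow> ('x, 'a) mpoly" and A
    by (induction A rule: infinite_finite_induct) (auto simp: add)
  have "mpoly_eval c v (p * q) = mpoly_eval c v p * mpoly_eval c v q" for p q
  proof -
    have "mpoly_eval c v (p * q) = (\<Sum>m\<in>Poly_Mapping.keys p. \<Sum>n\<in>Poly_Mapping.keys q.
        (c (Poly_Mapping.lookup p m) * monom_eval v m) *
        (c (Poly_Mapping.lookup q n) * monom_eval v n))"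
      by (simp add: poly_mapping_mult_eq_sum_single[of p q] sum
          mpoly_eval_single[where c=c, OF c_zero] unital_homD[OF c] monom_eval_add mult_ac)
    then show ?thesis by (simp add: mpoly_eval_def sum_product)
  qed
  moreover have "mpoly_eval c v 1 = 1"
    using mpoly_eval_const[where c=c and a=1, OF c_zero]
    by (simp add: unital_homD[OF c] unital_homD[OF unital_hom_const_mpoly])
  ultimately show ?thesis by (simp add: unital_hom_def add)
qed

lemma unital_hom_eval_self: "unital_hom eval_self"
  unfolding eval_self_eq_mpoly_eval by (rule unital_hom_mpoly_eval[OF unital_hom_ident])

lemma hom_apply_mpoly_eval:
  assumes "unital_hom f"
  shows "f (mpoly_eval c v p) = mpoly_eval (\<lambda>a. f (c a)) (\<lambda>x. f (v x)) p"
  by (simp add: mpoly_eval_def monom_eval_def unital_hom_sum[OF assms] unital_homD(4)[OF assms]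
      unital_hom_prod[OF assms] unital_hom_power[OF assms])

lemma mpoly_eval_const_var:
  fixes p :: "('x, 'a::comm_ring_1) mpoly"
  shows "mpoly_eval const_mpoly var_mpoly p = p"
proof -
  have power: "var_mpoly x ^ n = (Poly_Mapping.single (Poly_Mapping.single x n) 1 :: ('x, 'a) mpoly)"
    for x n
    by (induction n) (simp_all add: var_mpoly_def mult_single flip: single_add)
  have prod:
    "(\<Prod>x\<in>A. Poly_Mapping.single (f x) 1) = (Poly_Mapping.single (sum f A) 1 :: ('x, 'a) mpoly)"
    for A :: "'x set" and f
    by (induction A rule: infinite_finite_induct) (simp_all add: mult_single)
  have "monom_eval var_mpoly m = (Poly_Mapping.single m 1 :: ('x, 'a) mpoly)" for m
    by (simp add: monom_eval_def power prod flip: poly_mapping_eq_sum_single)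
  then show ?thesis
    by (simp add: mpoly_eval_def const_mpoly_def mult_single flip: poly_mapping_eq_sum_single)
qed

definition mpolys :: "'a::zero set \<Rightarrow> 'x set \<Rightarrow> ('x, 'a) mpoly set" where
  "mpolys F S = {p. \<forall>m\<in>Poly_Mapping.keys p. Poly_Mapping.lookup p m \<in> F \<and> Poly_Mapping.keys m \<subseteq> S}"

lemma mpolys_mono: "F \<subseteq> E \<Longrightarrow> S \<subseteq> T \<Longrightarrow> mpolys F S \<subseteq> mpolys E T"
  unfolding mpolys_def by blast

lemma mpolysD:
  assumes "p \<in> mpolys F S" "m \<in> Poly_Mapping.keys p"
  shows "Poly_Mapping.lookup p m \<in> F" "Poly_Mapping.keys m \<subseteq> S"
  using assms by (auto simp: mpolys_def)

lemma const_mpoly_in_mpolys: "a \<in> F \<Longrightarrow> const_mpoly a \<in> mpolys F S"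
  by (simp add: const_mpoly_def mpolys_def)

lemma var_mpoly_in_mpolys: "1 \<in> F \<Longrightarrow> x \<in> S \<Longrightarrow> var_mpoly x \<in> mpolys F S"
  by (simp add: var_mpoly_def mpolys_def)

lemma subring_set_mpolys:
  assumes F: "subring_set F"
  shows "subring_set (mpolys F S)"
proof -
  have lookup_in: "Poly_Mapping.lookup p m \<in> F" if "p \<in> mpolys F S" for p m
    using mpolysD(1)[OF that] subring_setD(1)[OF F] by (metis in_keys_iff)
  have "p * q \<in> mpolys F S" if p: "p \<in> mpolys F S" and q: "q \<in> mpolys F S" for p q
  proof -
    have keys: "Poly_Mapping.keys m \<subseteq> S" if m: "m \<in> Poly_Mapping.keys (p * q)" for m
    proof -
      obtain a b where "m = a + b" "a \<in> Poly_Mapping.keys p" "b \<in> Poly_Mapping.keys q"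
        using m keys_mult[of p q] by blast
      then show ?thesis using mpolysD(2)[OF p] mpolysD(2)[OF q] keys_add[of a b] by blast
    qed
    have "Poly_Mapping.lookup (p * q) m \<in> F" for m
      using lookup_in[OF p] lookup_in[OF q]
      by (auto simp: poly_mapping_mult_eq_sum_single[of p q] lookup_sum lookup_single when_def
          subring_setD[OF F] intro!: subring_set_sum[OF F])
    then show ?thesis using keys by (auto simp: mpolys_def)
  qed
  moreover have "p + q \<in> mpolys F S" if "p \<in> mpolys F S" "q \<in> mpolys F S" for p q
  proof -
    have "Poly_Mapping.keys m \<subseteq> S" if m: "m \<in> Poly_Mapping.keys (p + q)" for m
      using m \<open>p \<in> mpolys F S\<close> \<open>q \<in> mpolys F S\<close> keys_add[of p q] mpolysD(2) by blast
    moreover have "Poly_Mapping.lookup (p + q) m \<in> F" for m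
      using lookup_in that by (simp add: lookup_add subring_setD[OF F])
    ultimately show ?thesis by (simp add: mpolys_def)
  qed
  moreover have "- p \<in> mpolys F S" if "p \<in> mpolys F S" for p
    using that by (auto simp: mpolys_def subring_setD[OF F])
  moreover have "1 \<in> mpolys F S"
    using const_mpoly_in_mpolys[of 1 F S]
    by (simp add: subring_setD[OF F] unital_homD[OF unital_hom_const_mpoly])
  ultimately show ?thesis by (simp add: subring_set_def)
qed

lemma mpoly_eval_in_subring:
  assumes D: "subring_set D" and p: "p \<in> mpolys F S"
    and "\<And>a. a \<in> F \<Longrightarrow> c a \<in> D" "\<And>x. x \<in> S \<Longrightarrow> v x \<in> D"
  shows "mpoly_eval c v p \<in> D"
  unfolding mpoly_eval_def monom_eval_def
  using assms(3,4) mpolysD[OF p]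
  by (intro subring_set_sum[OF D] subring_setD(4)[OF D] subring_set_prod[OF D]
      subring_set_power[OF D]) blast+

lemma mpoly_eval_cong:
  assumes p: "p \<in> mpolys F S" and "\<And>a. a \<in> F \<Longrightarrow> c a = d a" "\<And>x. x \<in> S \<Longrightarrow> v x = w x"
  shows "mpoly_eval c v p = mpoly_eval d w p"
  unfolding mpoly_eval_def monom_eval_def
  using assms(2,3) mpolysD[OF p]
  by (intro sum.cong arg_cong2[where f="(*)"] prod.cong arg_cong2[where f="(^)"] refl) blast+

lemma adjoin_subset_fractions_mpolys:
  fixes c :: "'k::field \<Rightarrow> 'l::field"
  assumes c: "unital_hom c" and F: "subring_set F"
  shows "adjoin (c ` F) (v ` S) \<subseteq> fractions (mpoly_eval c v ` mpolys F S)"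
proof (rule adjoin_subset_fractions)
  show "subring_set (mpoly_eval c v ` mpolys F S)"
    by (rule subring_set_image[OF unital_hom_mpoly_eval[OF c] subring_set_mpolys[OF F]])
  show "c ` F \<subseteq> mpoly_eval c v ` mpolys F S"
  proof
    fix y assume "y \<in> c ` F"
    then obtain a where "a \<in> F" "y = c a" by blast
    then show "y \<in> mpoly_eval c v ` mpolys F S"
      using mpoly_eval_const[where c=c and a=a] unital_homD(1)[OF c] const_mpoly_in_mpolys
      by (metis imageI)
  qed
  show "v ` S \<subseteq> mpoly_eval c v ` mpolys F S"
  proof
    fix y assume "y \<in> v ` S"
    then obtain x where "x \<in> S" "y = v x" by blast
    then show "y \<in> mpoly_eval c v ` mpolys F S"
      using mpoly_eval_var[OF c] var_mpoly_in_mpolys subring_setD(2)[OF F] by (metis imageI)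
  qed
qed

definition rename_vars :: "('x \<Rightarrow> 'y) \<Rightarrow> ('x, 'a::comm_ring_1) mpoly \<Rightarrow> ('y, 'a) mpoly" where
  "rename_vars v = mpoly_eval const_mpoly (\<lambda>x. var_mpoly (v x))"

lemma rename_vars_0 [simp]: "rename_vars v 0 = 0"
  by (simp add: rename_vars_def)

lemma mpoly_eval_rename_vars:
  "unital_hom c \<Longrightarrow> mpoly_eval c w (rename_vars v p) = mpoly_eval c (\<lambda>x. w (v x)) p"
  by (simp add: rename_vars_def hom_apply_mpoly_eval[OF unital_hom_mpoly_eval]
      mpoly_eval_const mpoly_eval_var unital_homD)

lemma rename_vars_in_mpolys:
  "subring_set F \<Longrightarrow> p \<in> mpolys F S \<Longrightarrow> v ` S \<subseteq> T \<Longrightarrow> rename_vars v p \<in> mpolys F T"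
  unfolding rename_vars_def
  by (rule mpoly_eval_in_subring[OF subring_set_mpolys])
    (auto intro: const_mpoly_in_mpolys var_mpoly_in_mpolys subring_setD)

lemma rename_vars_inverse:
  assumes "p \<in> mpolys F S" "\<And>x. x \<in> S \<Longrightarrow> w (v x) = x"
  shows "rename_vars w (rename_vars v p) = p"
proof -
  have "rename_vars w (rename_vars v p) = mpoly_eval const_mpoly (\<lambda>x. var_mpoly (w (v x))) p"
    by (simp add: rename_vars_def[of w] mpoly_eval_rename_vars[OF unital_hom_const_mpoly])
  also have "\<dots> = mpoly_eval const_mpoly var_mpoly p"
    using assms by (intro mpoly_eval_cong[OF assms(1)]) auto
  finally show ?thesis by (simp add: mpoly_eval_const_var)
qed

lemma lookup_map_zero:
  "c 0 = 0 \<Longrightarrow> Poly_Mapping.lookup (Poly_Mapping.map c p) m = c (Poly_Mapping.lookup p m)"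
  by (simp add: Poly_Mapping.map.rep_eq when_def)

lemma keys_map_subset: "c 0 = 0 \<Longrightarrow> Poly_Mapping.keys (Poly_Mapping.map c p) \<subseteq> Poly_Mapping.keys p"
  by (auto simp: in_keys_iff lookup_map_zero)

lemma mpoly_eval_map:
  assumes "c 0 = 0" "d 0 = 0"
  shows "mpoly_eval d v (Poly_Mapping.map c p) = mpoly_eval (\<lambda>a. d (c a)) v p"
  using assms mpoly_eval_superset[of d "Poly_Mapping.keys p"] keys_map_subset[of c p]
  by (simp add: lookup_map_zero mpoly_eval_def[of "\<lambda>a. d (c a)"])

lemma map_in_mpolys:
  assumes c: "c 0 = 0" and p: "p \<in> mpolys F S"
  shows "Poly_Mapping.map c p \<in> mpolys (c ` F) S"
  unfolding mpolys_def
proof (intro CollectI ballI)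
  fix m assume "m \<in> Poly_Mapping.keys (Poly_Mapping.map c p)"
  then have "m \<in> Poly_Mapping.keys p" using keys_map_subset[of c p, OF c] by blast
  then show "Poly_Mapping.lookup (Poly_Mapping.map c p) m \<in> c ` F \<and> Poly_Mapping.keys m \<subseteq> S"
    using mpolysD[OF p] by (simp add: lookup_map_zero[of c p, OF c])
qed

section \<open>Algebraic independence\<close>

lemma alg_independent_iff:
  "alg_independent F S \<longleftrightarrow> (\<forall>p\<in>mpolys F S. eval_self p = 0 \<longrightarrow> p = 0)"
  by (auto simp: alg_independent_def mpolys_def)

lemma eval_self_rename_vars_map:
  fixes c :: "'k::field \<Rightarrow> 'l::field" and v :: "'x \<Rightarrow> 'l"
  assumes "unital_hom c"
  shows "eval_self (rename_vars v (Poly_Mapping.map c p)) = mpoly_eval c v p"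
  by (simp add: eval_self_eq_mpoly_eval mpoly_eval_rename_vars[OF unital_hom_ident]
      mpoly_eval_map unital_homD[OF assms])

lemma rename_vars_map_eq_0:
  fixes c :: "'a::comm_ring_1 \<Rightarrow> 'b::comm_ring_1"
  assumes c: "unital_hom c" "inj c" and v: "inj_on v S" and p: "p \<in> mpolys F S"
    and eq_0: "rename_vars v (Poly_Mapping.map c p) = 0"
  shows "p = 0"
proof -
  have c_zero: "c 0 = 0" by (rule unital_homD(1)[OF c(1)])
  have "Poly_Mapping.map c p = rename_vars (inv_into S v) (rename_vars v (Poly_Mapping.map c p))"
    by (rule rename_vars_inverse[OF map_in_mpolys[of c p F S, OF c_zero p], symmetric])
      (simp add: v)
  then have "Poly_Mapping.map c p = 0" by (simp add: eq_0)
  then show ?thesis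
    using c(2) c_zero by (intro poly_mapping_eqI) (metis injD lookup_map_zero lookup_zero)
qed

lemma mpolys_imageE:
  fixes c :: "'a::comm_ring_1 \<Rightarrow> 'b::comm_ring_1"
  assumes c: "unital_hom c" "inj c" and F: "subring_set F" and p: "p \<in> mpolys (c ` F) (v ` S)"
  obtains q where "q \<in> mpolys F S" "p = rename_vars v (Poly_Mapping.map c q)"
proof -
  let ?r = "rename_vars (inv_into S v) p" and ?d = "inv_into F c"
  let ?q = "Poly_Mapping.map ?d ?r"
  have c_zero: "c 0 = 0" by (rule unital_homD(1)[OF c(1)])
  have zero_in_F: "0 \<in> F" by (rule subring_setD(1)[OF F])
  have inj_F: "inj_on c F" using c(2) by (rule inj_on_subset) simp
  have d_zero: "?d 0 = 0" using inv_into_f_f[OF inj_F zero_in_F] c_zero by simp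
  have r: "?r \<in> mpolys (c ` F) S"
    by (rule rename_vars_in_mpolys[OF subring_set_image[OF c(1) F] p]) (auto simp: inv_into_into)
  have "?d ` c ` F = F"
    using inj_F by (simp add: image_image)
  then have "?q \<in> mpolys F S"
    using map_in_mpolys[of ?d ?r "c ` F" S, OF d_zero r] by simp
  moreover have "p = rename_vars v (Poly_Mapping.map c ?q)"
  proof -
    have "Poly_Mapping.lookup ?r m \<in> c ` F" for m
      using mpolysD(1)[OF r] zero_in_F c_zero by (metis imageI in_keys_iff)
    then have "Poly_Mapping.map c ?q = ?r"
      by (intro poly_mapping_eqI)
        (simp add: lookup_map_zero[of c ?q, OF c_zero] lookup_map_zero[of ?d ?r, OF d_zero] f_inv_into_f)
    moreover have "rename_vars v ?r = p"
      by (rule rename_vars_inverse[OF p]) (simp add: f_inv_into_f)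
    ultimately show ?thesis by simp
  qed
  ultimately show ?thesis using that by blast
qed

lemma alg_independent_image_iff_mpoly_eval:
  fixes c :: "'k::field \<Rightarrow> 'l::field" and v :: "'x \<Rightarrow> 'l"
  assumes c: "field_hom c" and F: "subring_set F" and v: "inj_on v S"
  shows "alg_independent (c ` F) (v ` S) \<longleftrightarrow> (\<forall>p\<in>mpolys F S. mpoly_eval c v p = 0 \<longrightarrow> p = 0)"
proof
  note hom_inj_c = field_hom_unital_hom[OF c] field_hom_inj[OF c]
  show "\<forall>p\<in>mpolys F S. mpoly_eval c v p = 0 \<longrightarrow> p = 0" if indep: "alg_independent (c ` F) (v ` S)"
  proof (intro ballI impI)
    fix p assume p: "p \<in> mpolys F S" and "mpoly_eval c v p = 0"
    then have "eval_self (rename_vars v (Poly_Mapping.map c p)) = 0"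
      by (simp add: eval_self_rename_vars_map[OF hom_inj_c(1)])
    moreover have "rename_vars v (Poly_Mapping.map c p) \<in> mpolys (c ` F) (v ` S)"
      using unital_homD(1)[OF hom_inj_c(1)] p
      by (intro rename_vars_in_mpolys map_in_mpolys subring_set_image[OF hom_inj_c(1) F]) auto
    ultimately have "rename_vars v (Poly_Mapping.map c p) = 0"
      using indep by (simp add: alg_independent_iff)
    then show "p = 0" by (rule rename_vars_map_eq_0[OF hom_inj_c v p])
  qed
  show "alg_independent (c ` F) (v ` S)" if inj: "\<forall>p\<in>mpolys F S. mpoly_eval c v p = 0 \<longrightarrow> p = 0"
    unfolding alg_independent_iff
  proof (intro ballI impI)
    fix p assume "p \<in> mpolys (c ` F) (v ` S)" and eval_0: "eval_self p = 0"
    then obtain q where q: "q \<in> mpolys F S" "p = rename_vars v (Poly_Mapping.map c q)"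
      using mpolys_imageE[OF hom_inj_c F] by metis
    then have "q = 0" using inj eval_0 by (simp add: eval_self_rename_vars_map[OF hom_inj_c(1)])
    moreover have "Poly_Mapping.map c (0 :: ('x, 'k) mpoly) = 0"
      by (rule poly_mapping_eqI) (simp add: lookup_map_zero unital_homD(1)[OF hom_inj_c(1)])
    ultimately show "p = 0"
      using q(2) by simp
  qed
qed

lemma alg_independent_image:
  assumes f: "field_hom f" and F: "subring_set F" and "alg_independent F S"
  shows "alg_independent (f ` F) (f ` S)"
proof -
  have "mpoly_eval f f p = f (eval_self p)" for p
    by (simp add: eval_self_eq_mpoly_eval hom_apply_mpoly_eval[OF field_hom_unital_hom[OF f]])
  moreover have "inj_on f S" using field_hom_inj[OF f] by (rule inj_on_subset) simp
  ultimately show ?thesis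
    using assms(3) alg_independent_image_iff_mpoly_eval[OF f F, of f S]
    by (simp add: field_hom_eq_0_iff[OF f] alg_independent_iff)
qed

lemma mpoly_eval_const_poly_upd:
  fixes p :: "('a, 'a::field) mpoly"
  assumes "p \<in> mpolys F T" "s \<notin> T"
  shows "mpoly_eval (\<lambda>a. [:a:]) ((\<lambda>x. [:x:])(s := q)) p = [:eval_self p:]"
proof -
  have "mpoly_eval (\<lambda>a. [:a:]) ((\<lambda>x. [:x:])(s := q)) p = mpoly_eval (\<lambda>a. [:a:]) (\<lambda>x. [:x:]) p"
    using assms(2) by (intro mpoly_eval_cong[OF assms(1)]) auto
  then show ?thesis
    by (simp add: eval_self_eq_mpoly_eval hom_apply_mpoly_eval[OF unital_hom_const_poly])
qed

lemma polys_over_mpoly_eval_lift: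
  fixes P :: "'a::field poly"
  assumes F: "subring_set F" and "s \<notin> T"
    and P: "P \<in> polys_over (eval_self ` mpolys F T)"
  obtains p where "p \<in> mpolys F (insert s T)" "eval_self p = poly P s"
    "mpoly_eval (\<lambda>a. [:a:]) ((\<lambda>x. [:x:])(s := [:0, 1:])) p = P"
proof -
  have "\<forall>n. \<exists>q\<in>mpolys F T. Polynomial.coeff P n = eval_self q"
    using P by (auto simp: polys_over_def)
  then obtain q where q: "\<And>n. q n \<in> mpolys F T"
    "\<And>n. Polynomial.coeff P n = eval_self (q n)"
    by metis
  define p where "p = (\<Sum>n\<le>Polynomial.degree P. q n * var_mpoly s ^ n)"
  have eval_p: "mpoly_eval c v p = (\<Sum>n\<le>Polynomial.degree P. mpoly_eval c v (q n) * v s ^ n)"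
    if c: "unital_hom c" for c and v :: "'a \<Rightarrow> 'z::comm_ring_1"
    using unital_hom_mpoly_eval[OF c, of v]
    by (simp add: p_def unital_hom_sum unital_homD unital_hom_power mpoly_eval_var[OF c])
  have "p \<in> mpolys F (insert s T)"
  proof -
    note subring = subring_set_mpolys[OF F]
    have "q n \<in> mpolys F (insert s T)" for n using q(1) mpolys_mono[of F F T "insert s T"] by blast
    moreover have "var_mpoly s \<in> mpolys F (insert s T)"
      by (simp add: var_mpoly_in_mpolys subring_setD(2)[OF F])
    ultimately show ?thesis
      unfolding p_def
      by (intro subring_set_sum[OF subring] subring_setD(4)[OF subring]
          subring_set_power[OF subring])
  qed
  moreover have "eval_self p = poly P s"
    by (simp add: eval_self_eq_mpoly_eval eval_p[OF unital_hom_ident] poly_altdef q(2))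
  moreover have "mpoly_eval (\<lambda>a. [:a:]) ((\<lambda>x. [:x:])(s := [:0, 1:])) p = P"
    by (simp add: eval_p[OF unital_hom_const_poly] mpoly_eval_const_poly_upd[OF q(1) \<open>s \<notin> T\<close>]
        poly_as_sum_of_monoms flip: q(2) monom_altdef)
  ultimately show ?thesis by (rule that)
qed

text \<open>With denominators cleared, a relation of \<open>s\<close> over \<open>F(T)\<close> is a polynomial relation among
  \<open>insert s T\<close>, and it is recovered by evaluating that polynomial at \<open>s = X\<close>.\<close>

lemma alg_independent_imp_not_algebraic:
  fixes F :: "'a::field set"
  assumes F: "subring_set F" and S: "alg_independent F S" and s: "s \<in> S" "T \<subseteq> S" "s \<notin> T"
  shows "\<not> algebraic_over (adjoin F T) s"
proof
  let ?D = "eval_self ` mpolys F T"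
  assume "algebraic_over (adjoin F T) s"
  moreover have "adjoin F T \<subseteq> fractions ?D"
    using adjoin_subset_fractions_mpolys[OF unital_hom_ident F, of "\<lambda>x. x" T]
    by (simp flip: eval_self_eq_mpoly_eval)
  ultimately have "algebraic_over (fractions ?D) s" by (rule algebraic_over_mono[rotated])
  moreover have "subring_set ?D"
    by (rule subring_set_image[OF unital_hom_eval_self subring_set_mpolys[OF F]])
  ultimately have "algebraic_over ?D s" by (rule algebraic_over_fractions[rotated])
  then obtain P where P: "P \<in> polys_over ?D" "P \<noteq> 0" "poly P s = 0"
    by (rule algebraic_overE)
  obtain p where p: "p \<in> mpolys F (insert s T)" "eval_self p = poly P s"
    "mpoly_eval (\<lambda>a. [:a:]) ((\<lambda>x. [:x:])(s := [:0, 1:])) p = P"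
    by (rule polys_over_mpoly_eval_lift[OF F s(3) P(1)])
  have "p \<in> mpolys F S" using p(1) mpolys_mono[of F F "insert s T" S] s(1,2) by blast
  then have "p = 0" using S p(2) P(3) by (simp add: alg_independent_iff)
  then show False using p(3) P(2) by simp
qed

lemma purely_transcendental_hom_extension:
  fixes i :: "'k::field \<Rightarrow> 'l::field" and j :: "'k \<Rightarrow> 'm::field"
  assumes i: "field_hom i" and j: "field_hom j"
    and S: "alg_independent (range i) S" "adjoin (range i) S = UNIV"
    and h: "inj_on h S" "alg_independent (range j) (h ` S)"
  obtains \<phi> where "field_hom \<phi>" "\<And>k. \<phi> (i k) = j k" "\<And>s. s \<in> S \<Longrightarrow> \<phi> s = h s"
proof -
  note hom_i = field_hom_unital_hom[OF i] and hom_j = field_hom_unital_hom[OF j]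
  let ?D = "mpolys UNIV S :: ('l, 'k) mpoly set"
  let ?e = "mpoly_eval i (\<lambda>x. x)" and ?f = "mpoly_eval j h"
  have "?e p = 0 \<longleftrightarrow> ?f p = 0" if "p \<in> ?D" for p
  proof -
    have "?e p = 0 \<longleftrightarrow> p = 0"
      using S(1) that alg_independent_image_iff_mpoly_eval[OF i subring_set_UNIV, of "\<lambda>x. x" S]
      by auto
    moreover have "?f p = 0 \<longleftrightarrow> p = 0"
      using h(2) that alg_independent_image_iff_mpoly_eval[OF j subring_set_UNIV h(1)] by auto
    ultimately show ?thesis by simp
  qed
  moreover have "fractions (?e ` ?D) = UNIV"
    using adjoin_subset_fractions_mpolys[OF hom_i subring_set_UNIV, of "\<lambda>x. x" S] S(2) by auto
  ultimately obtain \<phi> where \<phi>: "field_hom \<phi>" "\<And>p. p \<in> ?D \<Longrightarrow> \<phi> (?e p) = ?f p"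
    using fraction_hom_extension[of ?e ?f ?D] unital_hom_mpoly_eval hom_i hom_j
      subring_set_mpolys[OF subring_set_UNIV]
    by metis
  have "\<phi> (i k) = j k" for k
    using \<phi>(2)[OF const_mpoly_in_mpolys[of k]]
    by (simp add: mpoly_eval_const unital_homD(1)[OF hom_i] unital_homD(1)[OF hom_j])
  moreover have "\<phi> s = h s" if "s \<in> S" for s
    using \<phi>(2)[OF var_mpoly_in_mpolys[OF _ that]]
    by (simp add: mpoly_eval_var[OF hom_i] mpoly_eval_var[OF hom_j])
  ultimately show ?thesis using that \<phi>(1) by blast
qed

lemma purely_transcendental_isomorphism:
  fixes i :: "'k::field \<Rightarrow> 'l::field" and j :: "'k \<Rightarrow> 'm::field"
  assumes i: "field_hom i" and j: "field_hom j"
    and S: "alg_independent (range i) S" "adjoin (range i) S = UNIV"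
    and T: "alg_independent (range j) T" "adjoin (range j) T = UNIV"
    and h: "bij_betw h S T"
  obtains \<phi> where "field_hom \<phi>" "bij \<phi>" "\<And>k. \<phi> (i k) = j k"
proof -
  have h_bij: "inj_on h S" "h ` S = T" using h by (auto simp: bij_betw_def)
  obtain \<phi> where \<phi>: "field_hom \<phi>" "\<And>k. \<phi> (i k) = j k" "\<And>s. s \<in> S \<Longrightarrow> \<phi> s = h s"
    using purely_transcendental_hom_extension[OF i j S h_bij(1)] T(1) h_bij(2) by metis
  have "range \<phi> = \<phi> ` adjoin (range i) S" by (simp add: S(2))
  also have "\<dots> = adjoin (range j) T"
    using \<phi>(2,3) h_bij(2) by (simp add: image_adjoin[OF \<phi>(1)] image_image cong: image_cong)
  also have "\<dots> = UNIV" by (rule T(2))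
  finally have "bij \<phi>" using field_hom_inj[OF \<phi>(1)] by (simp add: bij_def)
  then show ?thesis using that \<phi>(1,2) by blast
qed

section \<open>Exchange property and transcendence degree\<close>

lemma not_algebraic_overD:
  assumes F: "subring_set F" and s: "\<not> algebraic_over F s"
    and c: "\<And>n. c n \<in> F" "(\<Sum>n\<le>N. c n * s ^ n) = 0" and "n \<le> N"
  shows "c n = 0"
proof -
  let ?p = "\<Sum>n\<le>N. Polynomial.monom (c n) n"
  have coeff_p: "Polynomial.coeff ?p m = (if m \<le> N then c m else 0)" for m
    by (auto simp: Polynomial.coeff_sum)
  have "?p \<in> polys_over F"
    unfolding polys_over_def using c(1) subring_setD(1)[OF F] by (simp add: coeff_p)
  moreover have "poly ?p s = 0"
    using c(2) by (simp add: poly_sum poly_monom)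
  ultimately have "?p = 0" using s by (auto simp: algebraic_over_iff)
  then show ?thesis using coeff_p[of n] \<open>n \<le> N\<close> by simp
qed

lemma algebraic_over_adjoin_singletonE:
  assumes F: "subring_set F" and s: "algebraic_over (adjoin F {b}) s"
  obtains P p where "P \<noteq> 0" "poly P s = 0" "\<And>n. p n \<in> polys_over F"
    "\<And>n. Polynomial.coeff P n = poly (p n) b"
proof -
  let ?D = "(\<lambda>p. poly p b) ` polys_over F"
  have "subring_set ?D"
    by (rule subring_set_image[OF unital_hom_poly subring_set_polys_over[OF F]])
  moreover have "algebraic_over (fractions ?D) s"
    by (rule algebraic_over_mono[OF adjoin_singleton_subset_fractions[OF F] s])
  ultimately have "algebraic_over ?D s" by (rule algebraic_over_fractions)
  then obtain P where P: "P \<in> polys_over ?D" "P \<noteq> 0" "poly P s = 0"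
    by (rule algebraic_overE)
  then have "\<forall>n. \<exists>p\<in>polys_over F. Polynomial.coeff P n = poly p b"
    by (auto simp: polys_over_def)
  then obtain p where "\<And>n. p n \<in> polys_over F" "\<And>n. Polynomial.coeff P n = poly (p n) b"
    by metis
  then show ?thesis using that P(2,3) by blast
qed

text \<open>A relation of \<open>s\<close> over \<open>F(b)\<close> with denominators cleared is a polynomial in two
  variables over \<open>F\<close>, which is read as a relation of \<open>b\<close> over \<open>F(s)\<close>.\<close>

lemma algebraic_over_exchange:
  assumes F: "subring_set F" and s: "algebraic_over (adjoin F {b}) s"
    and s_not_algebraic: "\<not> algebraic_over F s"
  shows "algebraic_over (adjoin F {s}) b"
proof -
  obtain P p where P: "P \<noteq> 0" "poly P s = 0"
    and p: "\<And>n. p n \<in> polys_over F" "\<And>n. Polynomial.coeff P n = poly (p n) b"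
    using algebraic_over_adjoin_singletonE[OF F s] by blast
  define Q where "Q = (\<Sum>n\<le>Polynomial.degree P. Polynomial.smult (s ^ n) (p n))"
  have coeff_Q:
    "Polynomial.coeff Q k = (\<Sum>n\<le>Polynomial.degree P. Polynomial.coeff (p n) k * s ^ n)" for k
    by (simp add: Q_def Polynomial.coeff_sum mult.commute)
  have "Q \<noteq> 0"
  proof
    assume "Q = 0"
    then have "Polynomial.coeff (p n) k = 0" if "n \<le> Polynomial.degree P" for n k
      using that coeff_Q[of k] polys_overD[OF p(1)]
      by (intro not_algebraic_overD[OF F s_not_algebraic, of "\<lambda>n. Polynomial.coeff (p n) k"]) auto
    then have "p (Polynomial.degree P) = 0" by (simp add: poly_eq_iff)
    then show False using p(2)[of "Polynomial.degree P"] P(1) by simp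
  qed
  moreover have "poly Q b = 0"
    using P(2) by (simp add: Q_def poly_sum poly_altdef[of P] p(2) mult.commute)
  moreover have "Q \<in> polys_over (adjoin F {s})"
  proof -
    note E = is_subfield_imp_subring_set[OF is_subfield_adjoin, of F "{s}"]
    have "p n \<in> polys_over (adjoin F {s})" "s \<in> adjoin F {s}" for n
      using p(1) polys_over_mono[OF adjoin_upper(1)] adjoin_upper(2)[of "{s}" F] by blast+
    then show ?thesis
      unfolding Q_def
      by (intro subring_set_sum[OF subring_set_polys_over[OF E]] smult_polys_over[OF E]
          subring_set_power[OF E])
  qed
  ultimately show ?thesis by (auto simp: algebraic_over_iff)
qed

context
  fixes R :: "'a::field ring"
  defines "R \<equiv> ring_of_type_algebra"
begin

interpretation R: field R
  unfolding R_def by (rule field_from_type_algebra)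

lemma ring_of_type_algebra_simps:
  "carrier R = UNIV" "mult R = (*)" "one R = 1" "zero R = 0" "add R = (+)"
  by (simp_all add: R_def ring_of_type_algebra_def fun_eq_iff)

lemma a_inv_ring_of_type_algebra: "a_inv R x = - x"
  by (rule R.minus_equality) (simp_all add: ring_of_type_algebra_simps)

lemma m_inv_ring_of_type_algebra: "x \<noteq> 0 \<Longrightarrow> m_inv R x = inverse x"
  by (rule R.inv_char) (simp_all add: ring_of_type_algebra_simps)

lemma nat_pow_ring_of_type_algebra: "x [^]\<^bsub>R\<^esub> (n::nat) = x ^ n"
  by (induction n) (simp_all add: ring_of_type_algebra_simps mult.commute)

lemma eval_ring_of_type_algebra: "R.eval l x = poly (Poly (rev l)) x"
  by (induction l)
    (simp_all add: ring_of_type_algebra_simps nat_pow_ring_of_type_algebra Poly_append poly_monom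
      mult.commute)

lemma subring_ring_of_type_algebra_iff: "subring F R \<longleftrightarrow> subring_set F"
proof
  assume "subring F R"
  from subringE[OF this] show "subring_set F"
    by (simp add: subring_set_def ring_of_type_algebra_simps a_inv_ring_of_type_algebra)
next
  assume "subring_set F"
  then show "subring F R"
    by (intro R.subringI)
      (simp_all add: ring_of_type_algebra_simps a_inv_ring_of_type_algebra subring_setD)
qed

lemma subfield_ring_of_type_algebra_iff: "subfield F R \<longleftrightarrow> is_subfield F"
proof
  assume F: "subfield F R"
  have "inverse x \<in> F" if "x \<in> F" for x
    using R.subfield_m_inv(1)[OF F, of x] that
    by (cases "x = 0") (simp_all add: ring_of_type_algebra_simps m_inv_ring_of_type_algebra)
  then show "is_subfield F"
    using subfieldE(1)[OF F]
    by (simp add: is_subfield_iff_subring_set subring_ring_of_type_algebra_iff)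
next
  assume "is_subfield F"
  then show "subfield F R"
    by (intro R.subfieldI')
      (auto simp: is_subfield_iff_subring_set subring_ring_of_type_algebra_iff
        ring_of_type_algebra_simps m_inv_ring_of_type_algebra)
qed

lemma carrier_univ_poly_ring_of_type_algebra_iff:
  "l \<in> carrier (univ_poly R F) \<longleftrightarrow> set l \<subseteq> F \<and> (l = [] \<or> hd l \<noteq> 0)"
  by (auto simp: univ_poly_def polynomial_def ring_of_type_algebra_simps)

lemma algebraic_ring_of_type_algebra_iff:
  fixes F :: "'a set"
  assumes F: "is_subfield F"
  shows "(R.algebraic over F) x \<longleftrightarrow> algebraic_over F x"
proof
  have subring: "subring F R"
    using F by (simp add: subring_ring_of_type_algebra_iff is_subfield_iff_subring_set)
  assume "(R.algebraic over F) x"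
  moreover have "x \<in> carrier R" by (simp add: ring_of_type_algebra_simps)
  ultimately obtain l where "l \<in> carrier (univ_poly R F)" "l \<noteq> []" "R.eval l x = zero R"
    using R.algebraicE[OF subring] by blast
  then have l: "set l \<subseteq> F" "l \<noteq> []" "hd l \<noteq> 0" "R.eval l x = 0"
    by (simp_all add: carrier_univ_poly_ring_of_type_algebra_iff ring_of_type_algebra_simps)
  have over_F: "Poly (rev l) \<in> polys_over F"
    using l(1) is_subfield_imp_subring_set[OF F] nth_mem[of _ "rev l"]
    by (auto simp: polys_over_def coeff_Poly_eq nth_default_def subring_setD)
  have "Polynomial.coeff (Poly (rev l)) (length l - 1) \<noteq> 0"
    using l(2,3) by (simp add: coeff_Poly_eq nth_default_def rev_nth hd_conv_nth)
  then have "Poly (rev l) \<noteq> 0" by (metis Polynomial.coeff_0)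
  then show "algebraic_over F x"
    using over_F l(4) by (auto simp: algebraic_over_iff eval_ring_of_type_algebra)
next
  assume "algebraic_over F x"
  then obtain p where p: "p \<in> polys_over F" "p \<noteq> 0" "poly p x = 0" by (rule algebraic_overE)
  have "rev (coeffs p) \<in> carrier (univ_poly R F)"
    using p(2) set_coeffs_polys_over[OF p(1)]
    by (simp add: carrier_univ_poly_ring_of_type_algebra_iff hd_rev last_coeffs_eq_coeff_degree)
  then show "(R.algebraic over F) x"
    using p(2,3)
    by (intro R.algebraicI) (auto simp: eval_ring_of_type_algebra ring_of_type_algebra_simps)
qed

lemma algebraic_over_trans:
  fixes F :: "'a set"
  assumes F: "is_subfield F" and b: "algebraic_over F b" and x: "algebraic_over (adjoin F {b}) x"
  shows "algebraic_over F x"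
proof -
  let ?E = "R.simple_extension F b"
  have subfield_F: "subfield F R" using F by (simp add: subfield_ring_of_type_algebra_iff)
  have carrier: "y \<in> carrier R" for y by (simp add: ring_of_type_algebra_simps)
  have algebraic_b: "(R.algebraic over F) b"
    using b by (simp add: algebraic_ring_of_type_algebra_iff[OF F])
  then have subfield_E: "subfield ?E R"
    using R.simple_extension_is_subfield[OF subfield_F carrier] by simp
  have "F \<subseteq> ?E"
    using R.simple_extension_incl[of F b] carrier by (simp add: ring_of_type_algebra_simps)
  moreover have "{b} \<subseteq> ?E"
    using R.simple_extension_mem[OF subfieldE(1)[OF subfield_F] carrier] by simp
  ultimately have "adjoin F {b} \<subseteq> ?E"
    using subfield_E by (intro adjoin_least) (simp_all add: subfield_ring_of_type_algebra_iff)
  then have "(R.algebraic over ?E) x"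
    using x subfield_E algebraic_over_mono
    by (metis algebraic_ring_of_type_algebra_iff subfield_ring_of_type_algebra_iff)
  then have "R.finite_dimension ?E (R.simple_extension ?E x)"
    using R.finite_dimension_simple_extension[OF subfield_E carrier] by simp
  moreover have "R.finite_dimension F ?E"
    using R.finite_dimension_simple_extension[OF subfield_F carrier] algebraic_b by simp
  ultimately have "R.finite_dimension F (R.simple_extension ?E x)"
    using R.telescopic_base_dim(1)[OF subfield_F subfield_E] by blast
  moreover have "subring (R.simple_extension ?E x) R" "x \<in> R.simple_extension ?E x"
    using R.simple_extension_is_subring R.simple_extension_mem subfieldE(1)[OF subfield_E] carrier
    by blast+
  ultimately have "(R.algebraic over F) x"
    using R.finite_dimension_imp_algebraic[OF subfield_F] by blast
  then show ?thesis by (simp add: algebraic_ring_of_type_algebra_iff[OF F])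
qed

end

lemma algebraic_over_exchange_set:
  assumes F: "subring_set F" and C: "finite C" "algebraic_over (adjoin F (Y \<union> C)) s"
    and Y: "\<not> algebraic_over (adjoin F Y) s"
  obtains b where "b \<in> C" "algebraic_over (adjoin F (insert s Y \<union> (C - {b}))) b"
proof -
  have "\<exists>b\<in>C. algebraic_over (adjoin F (insert s Y \<union> (C - {b}))) b"
    using C
  proof (induction C)
    case empty
    then show ?case using Y by simp
  next
    case (insert b C)
    let ?E = "adjoin F (Y \<union> C)"
    show ?case
    proof (cases "algebraic_over ?E s")
      case True
      then obtain a where a: "a \<in> C" "algebraic_over (adjoin F (insert s Y \<union> (C - {a}))) a"
        using insert.IH by blast
      moreover have "adjoin F (insert s Y \<union> (C - {a})) \<subseteq> adjoin F (insert s Y \<union> (insert b C - {a}))"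
        by (intro adjoin_mono) auto
      ultimately show ?thesis using algebraic_over_mono by blast
    next
      case False
      moreover have "algebraic_over (adjoin ?E {b}) s"
        using insert.prems by (simp add: adjoin_adjoin)
      ultimately have "algebraic_over (adjoin ?E {s}) b"
        using algebraic_over_exchange[OF is_subfield_imp_subring_set[OF is_subfield_adjoin]] by blast
      moreover have "adjoin ?E {s} = adjoin F (insert s Y \<union> (insert b C - {b}))"
        using insert.hyps(2) by (simp add: adjoin_adjoin)
      ultimately show ?thesis by auto
    qed
  qed
  then show ?thesis using that by blast
qed

lemma steinitz_exchange:
  assumes F: "subring_set F"
    and S: "alg_independent F S" "\<And>s. s \<in> S \<Longrightarrow> algebraic_over (adjoin F B) s"
    and B: "finite B" and Y: "finite Y" "Y \<subseteq> S"
  shows "\<exists>C\<subseteq>B. card C + card Y = card B \<and>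
    (\<forall>x. algebraic_over (adjoin F B) x \<longrightarrow> algebraic_over (adjoin F (Y \<union> C)) x)"
  using Y
proof (induction Y)
  case empty
  then show ?case by auto
next
  case (insert s Y)
  then obtain C where C: "C \<subseteq> B" "card C + card Y = card B"
    "\<And>x. algebraic_over (adjoin F B) x \<Longrightarrow> algebraic_over (adjoin F (Y \<union> C)) x"
    by auto
  have fin_C: "finite C" using C(1) B finite_subset by blast
  have "algebraic_over (adjoin F (Y \<union> C)) s" using C(3) S(2) insert.prems by simp
  moreover have "\<not> algebraic_over (adjoin F Y) s"
    using insert by (intro alg_independent_imp_not_algebraic[OF F S(1)]) auto
  ultimately obtain b where b: "b \<in> C" "algebraic_over (adjoin F (insert s Y \<union> (C - {b}))) b"
    using algebraic_over_exchange_set[OF F fin_C] by blast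
  let ?E = "adjoin F (insert s Y \<union> (C - {b}))"
  have "algebraic_over ?E x" if "algebraic_over (adjoin F B) x" for x
  proof (rule algebraic_over_trans[OF is_subfield_adjoin b(2)])
    have "adjoin F (Y \<union> C) \<subseteq> adjoin ?E {b}"
      unfolding adjoin_adjoin by (intro adjoin_mono) auto
    then show "algebraic_over (adjoin ?E {b}) x" by (rule algebraic_over_mono[OF _ C(3)[OF that]])
  qed
  moreover have "card (C - {b}) + card (insert s Y) = card B"
    using b(1) fin_C C(2) insert.hyps card_gt_0_iff[of C] by (auto simp: card_Diff_singleton)
  ultimately show ?case using C(1) by blast
qed

lemma alg_independent_card_le:
  assumes F: "subring_set F"
    and S: "alg_independent F S" "\<And>s. s \<in> S \<Longrightarrow> algebraic_over (adjoin F B) s"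
    and B: "finite B"
  shows "finite S" "card S \<le> card B"
proof -
  have card_le: "card Y \<le> card B" if "finite Y" "Y \<subseteq> S" for Y
    using steinitz_exchange[OF F S B that] by auto
  then show "finite S"
    using infinite_arbitrarily_large[of S "Suc (card B)"] by (metis not_less_eq_eq order_refl)
  then show "card S \<le> card B" using card_le by simp
qed

lemma transcendence_base_card_eq:
  assumes F: "subring_set F" and B: "transcendence_base F E B" "finite B"
    and S: "transcendence_base F E S"
  shows "finite S" "card S = card B"
proof -
  note base_defs = transcendence_base_def subset_iff
  show "finite S"
    using B S by (intro alg_independent_card_le(1)[OF F _ _ B(2)]) (auto simp: base_defs)
  moreover have "card S \<le> card B"
    using B S by (intro alg_independent_card_le(2)[OF F _ _ B(2)]) (auto simp: base_defs)
  ultimately show "card S = card B"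
    using B S
    by (intro antisym alg_independent_card_le(2)[OF F _ _ \<open>finite S\<close>]) (auto simp: base_defs)
qed

lemma alg_independent_imp_transcendence_base:
  "alg_independent F S \<Longrightarrow> transcendence_base F (adjoin F S) S"
  by (simp add: transcendence_base_def adjoin_upper algebraic_over_self is_subfield_imp_subring_set
      is_subfield_adjoin)

lemma purely_transcendental_finite_generators:
  assumes F: "subring_set F" and "purely_transcendental F E" "has_finite_trdeg F E n"
  obtains S where "alg_independent F S" "adjoin F S = E" "finite S" "card S = n"
proof -
  obtain S where S: "alg_independent F S" "adjoin F S = E"
    using assms(2) by (auto simp: purely_transcendental_def)
  obtain B where B: "transcendence_base F E B" "finite B" "card B = n"
    using assms(3) by (auto simp: has_finite_trdeg_def)
  have "transcendence_base F E S"
    using alg_independent_imp_transcendence_base[OF S(1)] S(2) by simp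
  from transcendence_base_card_eq[OF F B(1,2) this] show ?thesis
    using that S B(3) by blast
qed

section \<open>Bases over a subfield\<close>

definition lin_independent_over :: "'a::field set \<Rightarrow> 'a set \<Rightarrow> bool" where
  "lin_independent_over F A \<longleftrightarrow>
     (\<forall>S c. finite S \<and> S \<subseteq> A \<and> c ` S \<subseteq> F \<and> (\<Sum>a\<in>S. c a * a) = 0 \<longrightarrow> (\<forall>a\<in>S. c a = 0))"

definition span_over :: "'a::field set \<Rightarrow> 'a set \<Rightarrow> 'a set" where
  "span_over F A = {\<Sum>a\<in>S. c a * a |S c. finite S \<and> S \<subseteq> A \<and> c ` S \<subseteq> F}"

lemma in_span_over_iff:
  "x \<in> span_over F A \<longleftrightarrow> (\<exists>S c. finite S \<and> S \<subseteq> A \<and> c ` S \<subseteq> F \<and> x = (\<Sum>a\<in>S. c a * a))"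
  unfolding span_over_def by blast

lemma basis_over_iff: "basis_over F A \<longleftrightarrow> lin_independent_over F A \<and> span_over F A = UNIV"
  unfolding basis_over_def lin_independent_over_def[symmetric] in_span_over_iff[symmetric] by blast

lemma lin_independent_overD:
  "lin_independent_over F A \<Longrightarrow> finite S \<Longrightarrow> S \<subseteq> A \<Longrightarrow> c ` S \<subseteq> F \<Longrightarrow> (\<Sum>a\<in>S. c a * a) = 0 \<Longrightarrow>
     a \<in> S \<Longrightarrow> c a = 0"
  unfolding lin_independent_over_def by blast

lemma span_overI: "finite S \<Longrightarrow> S \<subseteq> A \<Longrightarrow> c ` S \<subseteq> F \<Longrightarrow> (\<Sum>a\<in>S. c a * a) \<in> span_over F A"
  unfolding in_span_over_iff by blast

lemma subset_span_over:
  assumes "1 \<in> F"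
  shows "A \<subseteq> span_over F A"
proof
  fix a assume "a \<in> A"
  then show "a \<in> span_over F A"
    using span_overI[of "{a}" A "\<lambda>_. 1" F] assms by simp
qed

lemma lin_independent_over_Union_chain:
  assumes "\<C> \<noteq> {}" "subset.chain {A. lin_independent_over F A} \<C>"
  shows "lin_independent_over F (\<Union>\<C>)"
  unfolding lin_independent_over_def
proof (intro allI impI ballI)
  fix S c a
  assume S: "finite S \<and> S \<subseteq> \<Union>\<C> \<and> c ` S \<subseteq> F \<and> (\<Sum>a\<in>S. c a * a) = 0" and "a \<in> S"
  then obtain A where A: "A \<in> \<C>" "S \<subseteq> A"
    using finite_subset_Union_chain[OF _ _ assms] by metis
  then have "lin_independent_over F A" using assms(2) by (auto simp: subset.chain_def)
  then show "c a = 0" using lin_independent_overD S A(2) \<open>a \<in> S\<close> by blast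
qed

lemma in_span_over_of_dependent_insert:
  assumes F: "is_subfield F" and A: "lin_independent_over F A"
    and dependent: "\<not> lin_independent_over F (insert x A)"
  shows "x \<in> span_over F A"
proof -
  obtain S c where S: "finite S" "S \<subseteq> insert x A" "c ` S \<subseteq> F" "(\<Sum>a\<in>S. c a * a) = 0"
    and nontrivial: "\<exists>a\<in>S. c a \<noteq> 0"
    using dependent unfolding lin_independent_over_def by blast
  let ?T = "S - {x}"
  have T: "finite ?T" "?T \<subseteq> A" "c ` ?T \<subseteq> F" using S by auto
  have x: "x \<in> S" "c x \<noteq> 0"
  proof -
    have "x \<in> S \<and> c x \<noteq> 0"
    proof (rule ccontr)
      assume no_x: "\<not> (x \<in> S \<and> c x \<noteq> 0)"
      have "(\<Sum>a\<in>?T. c a * a) = (\<Sum>a\<in>S. c a * a)"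
        using no_x S(1) by (intro sum.mono_neutral_left) auto
      then have "c a = 0" if "a \<in> ?T" for a
        using lin_independent_overD[OF A T] S(4) that by simp
      then show False using nontrivial no_x by blast
    qed
    then show "x \<in> S" "c x \<noteq> 0" by auto
  qed
  have "c x * x = - (\<Sum>a\<in>?T. c a * a)"
    using S(4) sum.remove[OF S(1) x(1), of "\<lambda>a. c a * a"] by (simp add: eq_neg_iff_add_eq_0)
  then have "x = - inverse (c x) * (\<Sum>a\<in>?T. c a * a)"
    using x(2) by (simp add: field_simps)
  then have "x = (\<Sum>a\<in>?T. (- inverse (c x) * c a) * a)"
    by (simp add: sum_distrib_left mult.assoc)
  moreover have "(\<lambda>a. - inverse (c x) * c a) ` ?T \<subseteq> F"
    using S(3) x(1) F unfolding is_subfield_def by blast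
  ultimately show ?thesis using span_overI[OF T(1,2)] by metis
qed

lemma exists_basis_over:
  assumes F: "is_subfield F"
  obtains A where "basis_over F A"
proof -
  have "\<exists>A\<in>{A. lin_independent_over F A}. \<forall>B\<in>{A. lin_independent_over F A}. A \<subseteq> B \<longrightarrow> B = A"
  proof (rule subset_Zorn_nonempty)
    have "lin_independent_over F {}" by (auto simp: lin_independent_over_def)
    then show "{A. lin_independent_over F A} \<noteq> {}" by blast
  qed (simp add: lin_independent_over_Union_chain)
  then obtain A where A: "lin_independent_over F A"
    and max: "\<And>B. lin_independent_over F B \<Longrightarrow> A \<subseteq> B \<Longrightarrow> B = A"
    by auto
  have "x \<in> span_over F A" for x
  proof (cases "x \<in> A")
    case True
    then show ?thesis
      using subset_span_over is_subfield_imp_subring_set[OF F] subring_setD(2) by blast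
  next
    case False
    then have "\<not> lin_independent_over F (insert x A)" using max[of "insert x A"] by auto
    then show ?thesis by (rule in_span_over_of_dependent_insert[OF F A])
  qed
  then have "basis_over F A" using A by (auto simp: basis_over_iff)
  then show ?thesis by (rule that)
qed

section \<open>Finite groups of automorphisms\<close>

lemma field_homs_eqI:
  assumes "field_hom f" "field_hom g" "adjoin F S = UNIV"
    and "\<And>x. x \<in> F \<Longrightarrow> f x = g x" "\<And>x. x \<in> S \<Longrightarrow> f x = g x"
  shows "f = g"
proof -
  have "adjoin F S \<subseteq> {x. f x = g x}"
    using assms by (intro adjoin_least is_subfield_equalizer) auto
  then show ?thesis using assms(3) by auto
qed

lemma AutD:
  assumes "\<sigma> \<in> Aut F"
  shows "field_hom \<sigma>" "bij \<sigma>" "x \<in> F \<Longrightarrow> \<sigma> x = x"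
  using assms by (auto simp: Aut_def)

lemma Aut_root:
  assumes \<sigma>: "\<sigma> \<in> Aut F" and p: "p \<in> polys_over F" and root: "poly p x = 0"
  shows "poly p (\<sigma> x) = 0"
proof -
  note hom_\<sigma> = field_hom_unital_hom[OF AutD(1)[OF \<sigma>]]
  have "map_poly \<sigma> p = p"
    using p AutD(3)[OF \<sigma>] by (auto simp: map_poly_eq_self_iff[OF hom_\<sigma>] polys_over_def)
  then show ?thesis
    using poly_map_poly_hom[OF hom_\<sigma>, of p x] root by (simp add: unital_homD(1)[OF hom_\<sigma>])
qed

lemma subset_Aut_fixed_field: "G \<subseteq> Aut F \<Longrightarrow> G \<subseteq> Aut (fixed_field G)"
  by (auto simp: Aut_def fixed_field_def)

lemma finite_automorphisms:
  assumes G: "G \<subseteq> Aut F" and T: "finite T" "adjoin F T = UNIV"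
    and alg: "\<And>t. t \<in> T \<Longrightarrow> algebraic_over (fixed_field G) t"
  shows "finite G"
proof -
  have "\<exists>p. p \<in> polys_over (fixed_field G) \<and> p \<noteq> 0 \<and> poly p t = 0" if "t \<in> T" for t
    using alg[OF that] by (auto simp: algebraic_over_iff)
  then obtain p where p: "\<And>t. t \<in> T \<Longrightarrow> p t \<in> polys_over (fixed_field G)" "\<And>t. t \<in> T \<Longrightarrow> p t \<noteq> 0"
    "\<And>t. t \<in> T \<Longrightarrow> poly (p t) t = 0"
    by metis
  have "(\<lambda>g. restrict g T) ` G \<subseteq> (\<Pi>\<^sub>E t\<in>T. {y. poly (p t) y = 0})"
    using Aut_root p(1,3) subset_Aut_fixed_field[OF G] by fastforce
  moreover have "finite (\<Pi>\<^sub>E t\<in>T. {y. poly (p t) y = 0})"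
    using T(1) p(2) by (intro finite_PiE poly_roots_finite)
  moreover have "inj_on (\<lambda>g. restrict g T) G"
  proof (rule inj_onI)
    fix g h assume gh: "g \<in> G" "h \<in> G" "restrict g T = restrict h T"
    then have g: "g \<in> Aut F" and h: "h \<in> Aut F" using G by auto
    show "g = h"
    proof (rule field_homs_eqI[OF AutD(1)[OF g] AutD(1)[OF h] T(2)])
      show "g x = h x" if "x \<in> F" for x using AutD(3)[OF g that] AutD(3)[OF h that] by simp
      show "g x = h x" if "x \<in> T" for x using fun_cong[OF gh(3), of x] that by simp
    qed
  qed
  ultimately show ?thesis using finite_imageD finite_subset by metis
qed

text \<open>The coefficients of \<open>\<Prod>h\<in>H. (X - h x)\<close> are fixed by \<open>H\<close>, hence by \<open>\<tau>\<close>, which therefore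
  maps the root \<open>x\<close> to a root.\<close>

lemma hom_agrees_on_orbit:
  fixes x :: "'a::idom"
  assumes H: "finite H" "(\<lambda>y. y) \<in> H" "\<And>h. h \<in> H \<Longrightarrow> unital_hom h" "\<And>h. h \<in> H \<Longrightarrow> (\<circ>) h ` H = H"
    and \<tau>: "unital_hom \<tau>" "\<And>y. (\<And>h. h \<in> H \<Longrightarrow> h y = y) \<Longrightarrow> \<tau> y = y"
  obtains h where "h \<in> H" "\<tau> x = h x"
proof -
  define Q where "Q = (\<Prod>g\<in>H. [:- g x, 1:])"
  have "map_poly h Q = Q" if h: "h \<in> H" for h
  proof -
    note hom_h = H(3)[OF h]
    have inj: "inj_on ((\<circ>) h) H"
      using H(1) H(4)[OF h] by (simp add: eq_card_imp_inj_on)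
    have "map_poly h Q = (\<Prod>g\<in>H. [:- (h \<circ> g) x, 1:])"
      by (simp add: Q_def unital_hom_prod[OF unital_hom_map_poly[OF hom_h]] map_poly_pCons
          unital_homD[OF hom_h] unital_hom_uminus[OF hom_h])
    also have "\<dots> = (\<Prod>g\<in>(\<circ>) h ` H. [:- g x, 1:])"
      by (simp add: prod.reindex[OF inj])
    finally show ?thesis by (simp add: H(4)[OF h] Q_def)
  qed
  then have "h (Polynomial.coeff Q n) = Polynomial.coeff Q n" if "h \<in> H" for h n
    using that by (metis H(3) coeff_map_poly_hom)
  then have "map_poly \<tau> Q = Q"
    using \<tau>(2) by (simp add: poly_eq_iff coeff_map_poly_hom[OF \<tau>(1)])
  moreover have "poly Q x = 0"
    unfolding Q_def poly_prod using H(1,2) by (auto intro!: bexI[of _ "\<lambda>y. y"])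
  ultimately have "poly Q (\<tau> x) = 0"
    using poly_map_poly_hom[OF \<tau>(1), of Q x] by (simp add: unital_homD(1)[OF \<tau>(1)])
  then show ?thesis
    using that H(1) by (auto simp: Q_def poly_prod)
qed

lemma Aut_fixed_field_agrees_on_poly:
  fixes G :: "('a::field \<Rightarrow> 'a) set"
  assumes G: "G \<subseteq> Aut F" "finite G" "id \<in> G" "\<And>g. g \<in> G \<Longrightarrow> (\<circ>) g ` G = G"
    and \<tau>: "\<tau> \<in> Aut (fixed_field G)"
  obtains g where "g \<in> G" "map_poly \<tau> p = map_poly g p"
proof -
  have hom_G: "unital_hom g" if "g \<in> G" for g
    using that G(1) AutD(1) by (blast intro: field_hom_unital_hom)
  note hom_\<tau> = field_hom_unital_hom[OF AutD(1)[OF \<tau>]]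
  obtain h where "h \<in> map_poly ` G" "map_poly \<tau> p = h p"
  proof (rule hom_agrees_on_orbit[of "map_poly ` G" "map_poly \<tau>" p])
    show "finite (map_poly ` G)" using G(2) by simp
    have "map_poly id = (\<lambda>q :: 'a poly. q)" by (simp add: fun_eq_iff map_poly_id)
    then show "(\<lambda>q. q) \<in> map_poly ` G" using G(3) by (metis imageI)
    show "unital_hom h" if "h \<in> map_poly ` G" for h
      using that hom_G by (auto intro: unital_hom_map_poly)
    show "(\<circ>) h ` map_poly ` G = map_poly ` G" if h: "h \<in> map_poly ` G" for h
    proof -
      obtain g where g: "g \<in> G" "h = map_poly g" using h by blast
      have "map_poly g \<circ> map_poly g' = map_poly (g \<circ> g')" if "g' \<in> G" for g'
        using hom_G[OF g(1)] hom_G[OF that] by (simp add: fun_eq_iff map_poly_map_poly unital_homD)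
      then have "(\<circ>) h ` map_poly ` G = map_poly ` (\<circ>) g ` G"
        by (simp add: g(2) image_image cong: image_cong)
      then show ?thesis by (simp only: G(4)[OF g(1)])
    qed
    show "unital_hom (map_poly \<tau>)" by (rule unital_hom_map_poly[OF hom_\<tau>])
    show "map_poly \<tau> q = q" if fixed: "\<And>h. h \<in> map_poly ` G \<Longrightarrow> h q = q" for q
    proof -
      have "g (Polynomial.coeff q n) = Polynomial.coeff q n" if "g \<in> G" for g n
        using fixed that by (metis coeff_map_poly_hom hom_G imageI)
      then show ?thesis
        using AutD(3)[OF \<tau>]
        by (simp add: map_poly_eq_self_iff[OF hom_\<tau>] polys_over_def fixed_field_def)
    qed
  qed
  then show ?thesis using that by blast
qed

text \<open>Applied to the polynomial whose coefficients are the generators, the orbit argument yields a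
  single \<open>g\<close> that agrees with \<open>\<tau>\<close> on all generators at once.\<close>

lemma Aut_fixed_field_subset:
  fixes G :: "('a::field \<Rightarrow> 'a) set"
  assumes G: "G \<subseteq> Aut F" "finite G" "id \<in> G" "\<And>g. g \<in> G \<Longrightarrow> (\<circ>) g ` G = G"
    and T: "finite T" "adjoin F T = UNIV"
  shows "Aut (fixed_field G) \<subseteq> G"
proof
  fix \<tau> assume \<tau>: "\<tau> \<in> Aut (fixed_field G)"
  obtain ts where ts: "set ts = T" using finite_list[OF T(1)] by auto
  obtain g where g: "g \<in> G" "map_poly \<tau> (Poly ts) = map_poly g (Poly ts)"
    using Aut_fixed_field_agrees_on_poly[OF G \<tau>] .
  have g_Aut: "g \<in> Aut F" using g(1) G(1) by blast
  have "\<tau> = g"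
  proof (rule field_homs_eqI[OF AutD(1)[OF \<tau>] AutD(1)[OF g_Aut] T(2)])
    show "\<tau> x = g x" if "x \<in> F" for x
    proof -
      have "x \<in> fixed_field G" using G(1) that AutD(3) by (auto simp: fixed_field_def)
      then show ?thesis using AutD(3)[OF \<tau>] AutD(3)[OF g_Aut that] by simp
    qed
    show "\<tau> t = g t" if t: "t \<in> T" for t
    proof -
      obtain k where "k < length ts" "t = ts ! k" using t ts by (metis in_set_conv_nth)
      then have "Polynomial.coeff (Poly ts) k = t" by (simp add: nth_default_def)
      then show ?thesis
        by (metis g(2) coeff_map_poly_hom field_hom_unital_hom AutD(1)[OF \<tau>] AutD(1)[OF g_Aut])
    qed
  qed
  then show "\<tau> \<in> G" using g(1) by simp
qed

lemma Aut_fixed_field_eq: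
  assumes G: "subgroup G (Aut_group F)" "finite G" and T: "finite T" "adjoin F T = UNIV"
  shows "Aut (fixed_field G) = G"
proof (rule antisym)
  have G_subset_Aut: "G \<subseteq> Aut F" using subgroup.subset[OF G(1)] by (simp add: Aut_group_def)
  then show "G \<subseteq> Aut (fixed_field G)" by (rule subset_Aut_fixed_field)
  have "(\<circ>) g ` G = G" if "g \<in> G" for g
  proof (rule endo_inj_surj[OF G(2)])
    show "(\<circ>) g ` G \<subseteq> G"
      using subgroup.m_closed[OF G(1) that] by (auto simp: Aut_group_def)
    have "inj g" using that G_subset_Aut AutD(2) bij_is_inj by blast
    then show "inj_on ((\<circ>) g) G" by (auto simp: inj_on_def fun_eq_iff)
  qed
  moreover have "id \<in> G" using subgroup.one_closed[OF G(1)] by (simp add: Aut_group_def)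
  ultimately show "Aut (fixed_field G) \<subseteq> G"
    using G_subset_Aut G(2) T by (intro Aut_fixed_field_subset)
qed

section \<open>Transport along an isomorphism\<close>

definition conjugate :: "('a \<Rightarrow> 'b) \<Rightarrow> ('a \<Rightarrow> 'a) \<Rightarrow> 'b \<Rightarrow> 'b" where
  "conjugate \<phi> \<sigma> = \<phi> \<circ> \<sigma> \<circ> the_inv \<phi>"

lemma conjugate_apply: "inj \<phi> \<Longrightarrow> conjugate \<phi> \<sigma> (\<phi> x) = \<phi> (\<sigma> x)"
  by (simp add: conjugate_def the_inv_f_f)

lemma conjugate_comp: "inj \<phi> \<Longrightarrow> conjugate \<phi> (\<sigma> \<circ> \<tau>) = conjugate \<phi> \<sigma> \<circ> conjugate \<phi> \<tau>"
  by (simp add: conjugate_def fun_eq_iff the_inv_f_f)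

lemma inj_conjugate:
  assumes "inj \<phi>"
  shows "inj (conjugate \<phi>)"
proof (rule injI)
  fix \<sigma> \<tau> assume "conjugate \<phi> \<sigma> = conjugate \<phi> \<tau>"
  then have "\<phi> (\<sigma> x) = \<phi> (\<tau> x)" for x by (metis assms conjugate_apply)
  then show "\<sigma> = \<tau>" using assms by (simp add: fun_eq_iff inj_eq)
qed

lemma eq_conjugateI:
  assumes "bij \<phi>" "\<And>x. \<rho> (\<phi> x) = \<phi> (\<sigma> x)"
  shows "\<rho> = conjugate \<phi> \<sigma>"
proof
  fix y
  obtain x where "y = \<phi> x" using assms(1) by (metis bij_pointE)
  then show "\<rho> y = conjugate \<phi> \<sigma> y" using assms by (simp add: conjugate_apply bij_is_inj)
qed

lemma conjugate_image_Aut: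
  assumes \<phi>: "field_hom \<phi>" "bij \<phi>"
  shows "conjugate \<phi> ` Aut F = Aut (\<phi> ` F)"
proof
  note \<phi>_inv = field_hom_the_inv[OF \<phi>] bij_betw_the_inv_into[OF \<phi>(2)]
  show "conjugate \<phi> ` Aut F \<subseteq> Aut (\<phi> ` F)"
    using \<phi> \<phi>_inv conjugate_apply[OF bij_is_inj[OF \<phi>(2)]]
    by (auto simp: Aut_def conjugate_def intro!: field_hom_comp bij_comp)
  show "Aut (\<phi> ` F) \<subseteq> conjugate \<phi> ` Aut F"
  proof
    fix \<tau> assume \<tau>: "\<tau> \<in> Aut (\<phi> ` F)"
    let ?\<sigma> = "the_inv \<phi> \<circ> \<tau> \<circ> \<phi>"
    have "?\<sigma> \<in> Aut F"
      using \<tau> \<phi> \<phi>_inv by (auto simp: Aut_def the_inv_f_f bij_is_inj intro!: field_hom_comp bij_comp)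
    moreover have "\<tau> = conjugate \<phi> ?\<sigma>"
      by (rule eq_conjugateI[OF \<phi>(2)]) (simp add: f_the_inv_into_f_bij_betw[OF \<phi>(2)])
    ultimately show "\<tau> \<in> conjugate \<phi> ` Aut F" by blast
  qed
qed

lemma fixed_field_conjugate:
  assumes "bij \<phi>"
  shows "fixed_field (conjugate \<phi> ` H) = \<phi> ` fixed_field H"
proof -
  have "\<phi> x \<in> fixed_field (conjugate \<phi> ` H) \<longleftrightarrow> x \<in> fixed_field H" for x
    using bij_is_inj[OF assms] by (auto simp: fixed_field_def conjugate_apply inj_eq)
  then show ?thesis using bij_is_surj[OF assms] by (auto simp: image_iff) (metis surjD)
qed

lemma subgroup_Aut_mono:
  assumes "F \<subseteq> E"
  shows "subgroup (Aut E) (Aut_group F)"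
proof -
  interpret E: group "Aut_group E" by (rule group_Aut_group)
  interpret F: group "Aut_group F" by (rule group_Aut_group)
  have subset: "Aut E \<subseteq> Aut F" using assms by (auto simp: Aut_def)
  show ?thesis
  proof (rule F.subgroupI)
    show "Aut E \<subseteq> carrier (Aut_group F)" using subset by (simp add: Aut_group_def)
    show "Aut E \<noteq> {}" using E.one_closed by (auto simp: Aut_group_def)
    show "inv\<^bsub>Aut_group F\<^esub> \<sigma> \<in> Aut E" if "\<sigma> \<in> Aut E" for \<sigma>
    proof -
      have "inv\<^bsub>Aut_group F\<^esub> \<sigma> = inv_into UNIV \<sigma>"
        using that Aut_inv[OF that] subset AutD(2)[OF that]
        by (intro F.inv_equality) (auto simp: Aut_group_def bij_is_inj)
      then show ?thesis using Aut_inv[OF that] by simp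
    qed
    show "\<sigma> \<otimes>\<^bsub>Aut_group F\<^esub> \<tau> \<in> Aut E" if "\<sigma> \<in> Aut E" "\<tau> \<in> Aut E" for \<sigma> \<tau>
      using E.m_closed[of \<sigma> \<tau>] that by (simp add: Aut_group_def)
  qed
qed

lemma transcendence_base_image:
  assumes f: "field_hom f" and F: "subring_set F" and B: "transcendence_base F E B"
  shows "transcendence_base (f ` F) (f ` E) (f ` B)"
  using B alg_independent_image[OF f F] algebraic_over_image[OF f]
  unfolding transcendence_base_def by (auto simp flip: image_adjoin[OF f])

lemma spatially_isomorphic_iff_conjugate:
  "spatially_isomorphic i j G\<^sub>1 G\<^sub>2 \<longleftrightarrow>
     subgroup G\<^sub>1 (Aut_group (range i)) \<and> subgroup G\<^sub>2 (Aut_group (range j)) \<and>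
     (\<exists>\<phi>. field_hom \<phi> \<and> bij \<phi> \<and> (\<forall>k. \<phi> (i k) = j k) \<and> conjugate \<phi> ` G\<^sub>1 = G\<^sub>2)"
    (is "?lhs \<longleftrightarrow> ?rhs")
proof
  assume ?lhs
  then obtain \<psi> \<phi>
    where subgroups: "subgroup G\<^sub>1 (Aut_group (range i))" "subgroup G\<^sub>2 (Aut_group (range j))"
    and \<psi>: "\<psi> \<in> iso ((Aut_group (range i))\<lparr>carrier := G\<^sub>1\<rparr>) ((Aut_group (range j))\<lparr>carrier := G\<^sub>2\<rparr>)"
    and \<phi>: "field_hom \<phi>" "bij \<phi>" "\<forall>k. \<phi> (i k) = j k"
    and spatial: "\<And>g x. g \<in> G\<^sub>1 \<Longrightarrow> g x = the_inv \<phi> (\<psi> g (\<phi> x))"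
    unfolding spatially_isomorphic_def by blast
  have "\<psi> g = conjugate \<phi> g" if "g \<in> G\<^sub>1" for g
    using f_the_inv_into_f_bij_betw[OF \<phi>(2)] spatial[OF that] by (intro eq_conjugateI[OF \<phi>(2)]) simp
  moreover have "\<psi> ` G\<^sub>1 = G\<^sub>2" using \<psi> by (auto simp: iso_def bij_betw_def)
  ultimately have "conjugate \<phi> ` G\<^sub>1 = G\<^sub>2" by force
  then show ?rhs using subgroups \<phi> by blast
next
  assume ?rhs
  then obtain \<phi>
    where subgroups: "subgroup G\<^sub>1 (Aut_group (range i))" "subgroup G\<^sub>2 (Aut_group (range j))"
    and \<phi>: "field_hom \<phi>" "bij \<phi>" "\<forall>k. \<phi> (i k) = j k" and image: "conjugate \<phi> ` G\<^sub>1 = G\<^sub>2"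
    by blast
  note inj = bij_is_inj[OF \<phi>(2)]
  have "conjugate \<phi> \<in>
      iso ((Aut_group (range i))\<lparr>carrier := G\<^sub>1\<rparr>) ((Aut_group (range j))\<lparr>carrier := G\<^sub>2\<rparr>)"
    using image inj_on_subset[OF inj_conjugate[OF inj]]
    by (auto simp: iso_def hom_def bij_betw_def Aut_group_def conjugate_comp[OF inj])
  moreover have
    "g x = the_inv \<phi> (conjugate \<phi> g (\<phi> x)) \<and> (g x = x \<longleftrightarrow> conjugate \<phi> g (\<phi> x) = \<phi> x)" for g x
    using inj by (simp add: conjugate_apply the_inv_f_f inj_eq)
  ultimately show ?lhs using subgroups \<phi> unfolding spatially_isomorphic_def by blast
qed

lemma noether_solution_iff_transcendence_base:
  "noether_solution F G \<longleftrightarrow>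
     subgroup G (Aut_group F) \<and> (\<exists>S. transcendence_base F UNIV S \<and> fixed_field G = adjoin F S)"
  unfolding noether_solution_def purely_transcendental_def transcendence_base_def by auto

lemma noether_solution_Aut_eq:
  assumes T: "finite T" "adjoin F T = UNIV" and "noether_solution F G"
  shows "Aut (fixed_field G) = G"
proof (rule Aut_fixed_field_eq)
  show G: "subgroup G (Aut_group F)" using assms(3) by (simp add: noether_solution_def)
  show "finite G"
    using subgroup.subset[OF G] assms(3)
    by (intro finite_automorphisms[OF _ T]) (simp_all add: Aut_group_def noether_solution_def)
qed (fact T)+

lemma noether_solution_imp_nice_basis:
  fixes i :: "'k::field \<Rightarrow> 'l::field" and j :: "'k \<Rightarrow> 'm::field"
  assumes j: "field_hom j" and T: "finite T" "adjoin (range j) T = UNIV"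
    and \<phi>: "field_hom \<phi>" "bij \<phi>" "\<And>k. \<phi> (i k) = j k"
    and G: "noether_solution (range j) G"
  obtains \<Delta> A where "nice_basis (range i) \<Delta> A" "galois_over (adjoin (range i) \<Delta>)"
    "spatially_isomorphic i j (Aut (adjoin (range i) \<Delta>)) G"
proof -
  obtain S where S: "transcendence_base (range j) UNIV S" "fixed_field G = adjoin (range j) S"
    using G by (auto simp: noether_solution_iff_transcendence_base)
  define \<Delta> where "\<Delta> = the_inv \<phi> ` S"
  let ?F = "adjoin (range i) \<Delta>"
  have \<phi>_inv: "\<phi> (the_inv \<phi> y) = y" "the_inv \<phi> (\<phi> x) = x" for x y
    using \<phi>(2) by (simp_all add: f_the_inv_into_f_bij_betw the_inv_f_f bij_is_inj)
  have image_F: "\<phi> ` ?F = fixed_field G"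
    by (simp add: S(2) \<Delta>_def image_adjoin[OF \<phi>(1)] image_image \<phi>(3) \<phi>_inv)
  have conj_F: "conjugate \<phi> ` Aut ?F = G"
    by (simp add: conjugate_image_Aut[OF \<phi>(1,2)] image_F noether_solution_Aut_eq[OF T G])
  have base: "transcendence_base (range i) UNIV \<Delta>"
  proof -
    have "the_inv \<phi> ` range j = range i" by (simp add: image_image \<phi>_inv flip: \<phi>(3))
    moreover have "range (the_inv \<phi>) = UNIV"
      by (rule bij_is_surj[OF bij_betw_the_inv_into[OF \<phi>(2)]])
    ultimately show ?thesis
      using transcendence_base_image[OF field_hom_the_inv[OF \<phi>(1,2)] _ S(1)] is_subfield_range[OF j]
      by (simp add: is_subfield_imp_subring_set \<Delta>_def)
  qed
  obtain A where "basis_over ?F A" using exists_basis_over[OF is_subfield_adjoin] .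
  then have "nice_basis (range i) \<Delta> A" using base by (simp add: nice_basis_def)
  moreover have "galois_over ?F"
  proof -
    have "\<phi> ` fixed_field (Aut ?F) = \<phi> ` ?F"
      by (simp only: conj_F image_F flip: fixed_field_conjugate[OF \<phi>(2)])
    then show ?thesis by (simp add: galois_over_def inj_image_eq_iff[OF bij_is_inj[OF \<phi>(2)]])
  qed
  moreover have "spatially_isomorphic i j (Aut ?F) G"
    unfolding spatially_isomorphic_iff_conjugate
    using subgroup_Aut_mono[OF adjoin_upper(1)] G \<phi> conj_F by (auto simp: noether_solution_def)
  ultimately show ?thesis by (rule that)
qed

lemma nice_basis_imp_noether_solution:
  fixes i :: "'k::field \<Rightarrow> 'l::field" and j :: "'k \<Rightarrow> 'm::field"
  assumes i: "field_hom i" and \<Delta>: "nice_basis (range i) \<Delta> A"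
    and galois: "galois_over (adjoin (range i) \<Delta>)"
    and spatial: "spatially_isomorphic i j (Aut (adjoin (range i) \<Delta>)) G"
  shows "noether_solution (range j) G"
proof -
  obtain \<phi> where G: "subgroup G (Aut_group (range j))"
    and \<phi>: "field_hom \<phi>" "bij \<phi>" "\<And>k. \<phi> (i k) = j k"
    and conj_Aut: "conjugate \<phi> ` Aut (adjoin (range i) \<Delta>) = G"
    using spatial by (auto simp: spatially_isomorphic_iff_conjugate)
  have \<phi>_range: "\<phi> ` range i = range j" by (simp add: image_image \<phi>(3))
  have "fixed_field G = \<phi> ` adjoin (range i) \<Delta>"
    using galois by (simp add: fixed_field_conjugate[OF \<phi>(2)] galois_over_def flip: conj_Aut)
  also have "\<dots> = adjoin (range j) (\<phi> ` \<Delta>)"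
    by (simp add: image_adjoin[OF \<phi>(1)] \<phi>_range)
  finally have "fixed_field G = adjoin (range j) (\<phi> ` \<Delta>)" .
  moreover have "transcendence_base (range j) UNIV (\<phi> ` \<Delta>)"
    using transcendence_base_image[OF \<phi>(1), of "range i" UNIV \<Delta>] \<Delta> is_subfield_range[OF i]
    by (simp add: is_subfield_imp_subring_set nice_basis_def \<phi>_range bij_is_surj[OF \<phi>(2)])
  ultimately show ?thesis
    using G by (auto simp: noether_solution_iff_transcendence_base)
qed

theorem theorem8p21:
  fixes i :: "'k::field \<Rightarrow> 'l::field" and j :: "'k \<Rightarrow> 'm::field"
    and n :: nat and G :: "('m \<Rightarrow> 'm) set"
  assumes "field_hom i" and "field_hom j"
    and "purely_transcendental (range i) (UNIV :: 'l set)"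
    and "purely_transcendental (range j) (UNIV :: 'm set)"
    and "has_finite_trdeg (range i) (UNIV :: 'l set) n"
    and "has_finite_trdeg (range j) (UNIV :: 'm set) n"
    and "subgroup G (Aut_group (range j))"
  shows "noether_solution (range j) G \<longleftrightarrow>
    (\<exists>\<Delta> A. nice_basis (range i) \<Delta> A \<and>
       galois_over (adjoin (range i) \<Delta>) \<and>
       spatially_isomorphic i j (Aut (adjoin (range i) \<Delta>)) G)"
proof
  note subring = is_subfield_imp_subring_set[OF is_subfield_range]
  obtain S where S: "alg_independent (range i) S" "adjoin (range i) S = UNIV" "finite S" "card S = n"
    using purely_transcendental_finite_generators[OF subring[OF assms(1)] assms(3,5)] .
  obtain T where T: "alg_independent (range j) T" "adjoin (range j) T = UNIV" "finite T" "card T = n"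
    using purely_transcendental_finite_generators[OF subring[OF assms(2)] assms(4,6)] .
  obtain h where "bij_betw h S T"
    using finite_same_card_bij S(3,4) T(3,4) by metis
  then obtain \<phi> where \<phi>: "field_hom \<phi>" "bij \<phi>" "\<And>k. \<phi> (i k) = j k"
    using purely_transcendental_isomorphism[OF assms(1,2) S(1,2) T(1,2)] by metis
  assume "noether_solution (range j) G"
  then show "\<exists>\<Delta> A. nice_basis (range i) \<Delta> A \<and> galois_over (adjoin (range i) \<Delta>) \<and>
      spatially_isomorphic i j (Aut (adjoin (range i) \<Delta>)) G"
    using noether_solution_imp_nice_basis[OF assms(2) T(3,2) \<phi>] by metis
qed (use nice_basis_imp_noether_solution[OF assms(1)] in blast)

end
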